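(* Let $\mathcal{D}$ be an idempotent complete category. A functor $G:\mathcal{D}\to\mathcal{C}$ is a coreflection (resp. reflection, bireflection, equivalence) up to retracts if and only if it is a coreflection (resp. reflection, bireflection, equivalence).
   Context: A category is idempotent complete if every idempotent morphism $e:X\to X$ splits, i.e. there are $p:X\to Y$, $i:Y\to X$ with $e=i\circ p$ and $p\circ i=\mathrm{Id}_Y$. The idempotent completion $\mathcal{C}^\natural$ of a category $\mathcal{C}$ has as objects the pairs $(X,e)$ with $X$ an object of $\mathcal{C}$ and $e:X\to X$ idempotent; a morphism $f:(X,e)\to(X',e')$ is a morphism $f:X\to X'$ in $\mathcal{C}$ with $f=e'\circ f\circ e$; composition is that of $\mathcal{C}$ and $\mathrm{Id}_{(X,e)}=e$. A functor $F:\mathcal{C}\to\mathcal{D}$ induces its completion $F^\natural:\mathcal{C}^\natural\to\mathcal{D}^\natural$, $F^\natural(X,e)=(FX,Fe)$, $F^\natural(f)=F(f)$. A reflection is a functor admitting a fully faithful right adjoint. A coreflection is a functor admitting a fully faithful left adjoint. A bireflection is a functor $G:\mathcal{D}\to\mathcal{C}$ having a fully faithful functor $F:\mathcal{C}\to\mathcal{D}$ which is both a left and a right adjoint of $G$ and such that $\eta^r\circ\epsilon^l=\mathrm{Id}_{FG}$, where $\epsilon^l:FG\to\mathrm{Id}_{\mathcal{D}}$ is the counit of $F\dashv G$ and $\eta^r:\mathrm{Id}_{\mathcal{D}}\to FG$ is the unit of $G\dashv F$. A functor $F$ is a reflection (resp. coreflection, bireflection, equivalence) up to retracts if $F^\natural$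 is a reflection (resp. coreflection, bireflection, equivalence). *)

theory Defs
  imports Main
begin

section \<open>Categories\<close>

record ('o, 'm) cat =
  Ob :: "'o set"
  Ar :: "'m set"
  Dom :: "'m \<Rightarrow> 'o"
  Cod :: "'m \<Rightarrow> 'o"
  Iden :: "'o \<Rightarrow> 'm"
  Comp :: "'m \<Rightarrow> 'm \<Rightarrow> 'm"  (infixr "\<cdot>\<index>" 70)

definition hom :: "('o, 'm) cat \<Rightarrow> 'o \<Rightarrow> 'o \<Rightarrow> 'm set" where
  "hom C X Y = {f \<in> Ar C. Dom C f = X \<and> Cod C f = Y}"

locale category =
  fixes C :: "('o, 'm) cat" (structure)
  assumes Dom_Ob: "f \<in> Ar C \<Longrightarrow> Dom C f \<in> Ob C"
    and Cod_Ob: "f \<in> Ar C \<Longrightarrow> Cod C f \<in> Ob C"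
    and Id_hom: "X \<in> Ob C \<Longrightarrow> Iden C X \<in> hom C X X"
    and Comp_hom: "f \<in> hom C X Y \<Longrightarrow> g \<in> hom C Y Z \<Longrightarrow> g \<cdot> f \<in> hom C X Z"
    and Comp_Id: "f \<in> hom C X Y \<Longrightarrow> f \<cdot> Iden C X = f"
    and Id_Comp: "f \<in> hom C X Y \<Longrightarrow> Iden C Y \<cdot> f = f"
    and Comp_assoc:
      "f \<in> hom C W X \<Longrightarrow> g \<in> hom C X Y \<Longrightarrow> h \<in> hom C Y Z \<Longrightarrow> (h \<cdot> g) \<cdot> f = h \<cdot> (g \<cdot> f)"

definition is_iso :: "('o, 'm) cat \<Rightarrow> 'o \<Rightarrow> 'o \<Rightarrow> 'm \<Rightarrow> bool" where
  "is_iso C X Y f \<longleftrightarrow> f \<in> hom C X Y \<and>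
     (\<exists>g \<in> hom C Y X. g \<cdot>\<^bsub>C\<^esub> f = Iden C X \<and> f \<cdot>\<^bsub>C\<^esub> g = Iden C Y)"


section \<open>Functors and natural transformations\<close>

text \<open>Only the values of a functor on objects and arrows of its source are meaningful, and
  likewise only the components of a natural transformation at objects of the source; all
  conditions below are relativised accordingly.\<close>

record ('o1, 'm1, 'o2, 'm2) fnctr =
  omap :: "'o1 \<Rightarrow> 'o2"
  amap :: "'m1 \<Rightarrow> 'm2"

definition is_functor ::
  "('o1, 'm1) cat \<Rightarrow> ('o2, 'm2) cat \<Rightarrow> ('o1, 'm1, 'o2, 'm2) fnctr \<Rightarrow> bool" where
  "is_functor A B F \<longleftrightarrow> category A \<and> category B \<and>
     (\<forall>X \<in> Ob A. omap F X \<in> Ob B) \<and>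
     (\<forall>X \<in> Ob A. \<forall>Y \<in> Ob A. \<forall>f \<in> hom A X Y. amap F f \<in> hom B (omap F X) (omap F Y)) \<and>
     (\<forall>X \<in> Ob A. amap F (Iden A X) = Iden B (omap F X)) \<and>
     (\<forall>X \<in> Ob A. \<forall>Y \<in> Ob A. \<forall>Z \<in> Ob A. \<forall>f \<in> hom A X Y. \<forall>g \<in> hom A Y Z.
        amap F (g \<cdot>\<^bsub>A\<^esub> f) = amap F g \<cdot>\<^bsub>B\<^esub> amap F f)"

definition id_fun :: "('o, 'm, 'o, 'm) fnctr" where
  "id_fun = \<lparr>omap = (\<lambda>X. X), amap = (\<lambda>f. f)\<rparr>"

definition comp_fun ::
  "('o2, 'm2, 'o3, 'm3) fnctr \<Rightarrow> ('o1, 'm1, 'o2, 'm2) fnctr \<Rightarrow> ('o1, 'm1, 'o3, 'm3) fnctr"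
  (infixr "\<circ>\<^sub>F" 75) where
  "G \<circ>\<^sub>F F = \<lparr>omap = omap G \<circ> omap F, amap = amap G \<circ> amap F\<rparr>"

definition fully_faithful ::
  "('o1, 'm1) cat \<Rightarrow> ('o2, 'm2) cat \<Rightarrow> ('o1, 'm1, 'o2, 'm2) fnctr \<Rightarrow> bool" where
  "fully_faithful A B F \<longleftrightarrow> is_functor A B F \<and>
     (\<forall>X \<in> Ob A. \<forall>Y \<in> Ob A. bij_betw (amap F) (hom A X Y) (hom B (omap F X) (omap F Y)))"

definition is_nat_trans ::
  "('o1, 'm1) cat \<Rightarrow> ('o2, 'm2) cat \<Rightarrow> ('o1, 'm1, 'o2, 'm2) fnctr \<Rightarrow> ('o1, 'm1, 'o2, 'm2) fnctr
    \<Rightarrow> ('o1 \<Rightarrow> 'm2) \<Rightarrow> bool" where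
  "is_nat_trans A B F G \<tau> \<longleftrightarrow> is_functor A B F \<and> is_functor A B G \<and>
     (\<forall>X \<in> Ob A. \<tau> X \<in> hom B (omap F X) (omap G X)) \<and>
     (\<forall>X \<in> Ob A. \<forall>Y \<in> Ob A. \<forall>f \<in> hom A X Y.
        \<tau> Y \<cdot>\<^bsub>B\<^esub> amap F f = amap G f \<cdot>\<^bsub>B\<^esub> \<tau> X)"

definition is_nat_iso ::
  "('o1, 'm1) cat \<Rightarrow> ('o2, 'm2) cat \<Rightarrow> ('o1, 'm1, 'o2, 'm2) fnctr \<Rightarrow> ('o1, 'm1, 'o2, 'm2) fnctr
    \<Rightarrow> ('o1 \<Rightarrow> 'm2) \<Rightarrow> bool" where
  "is_nat_iso A B F G \<tau> \<longleftrightarrow> is_nat_trans A B F G \<tau> \<and>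
     (\<forall>X \<in> Ob A. is_iso B (omap F X) (omap G X) (\<tau> X))"


section \<open>Adjunctions, (co-, bi-)reflections, equivalences\<close>

text \<open>\<open>adjunction A B L R \<eta> \<epsilon>\<close>: the functor \<open>L : A \<rightarrow> B\<close> is left adjoint to \<open>R : B \<rightarrow> A\<close>, with
  unit \<open>\<eta>\<close> and counit \<open>\<epsilon>\<close>.\<close>

definition adjunction ::
  "('o1, 'm1) cat \<Rightarrow> ('o2, 'm2) cat \<Rightarrow> ('o1, 'm1, 'o2, 'm2) fnctr \<Rightarrow> ('o2, 'm2, 'o1, 'm1) fnctr
    \<Rightarrow> ('o1 \<Rightarrow> 'm1) \<Rightarrow> ('o2 \<Rightarrow> 'm2) \<Rightarrow> bool" where
  "adjunction A B L R \<eta> \<epsilon> \<longleftrightarrow>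
     is_functor A B L \<and> is_functor B A R \<and>
     is_nat_trans A A id_fun (R \<circ>\<^sub>F L) \<eta> \<and>
     is_nat_trans B B (L \<circ>\<^sub>F R) id_fun \<epsilon> \<and>
     (\<forall>X \<in> Ob A. \<epsilon> (omap L X) \<cdot>\<^bsub>B\<^esub> amap L (\<eta> X) = Iden B (omap L X)) \<and>
     (\<forall>Y \<in> Ob B. amap R (\<epsilon> Y) \<cdot>\<^bsub>A\<^esub> \<eta> (omap R Y) = Iden A (omap R Y))"

definition reflection ::
  "('o1, 'm1) cat \<Rightarrow> ('o2, 'm2) cat \<Rightarrow> ('o1, 'm1, 'o2, 'm2) fnctr \<Rightarrow> bool" where
  "reflection D C G \<longleftrightarrow> is_functor D C G \<and>
     (\<exists>F \<eta> \<epsilon>. adjunction D C G F \<eta> \<epsilon> \<and> fully_faithful C D F)"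

definition coreflection ::
  "('o1, 'm1) cat \<Rightarrow> ('o2, 'm2) cat \<Rightarrow> ('o1, 'm1, 'o2, 'm2) fnctr \<Rightarrow> bool" where
  "coreflection D C G \<longleftrightarrow> is_functor D C G \<and>
     (\<exists>F \<eta> \<epsilon>. adjunction C D F G \<eta> \<epsilon> \<and> fully_faithful C D F)"

definition bireflection ::
  "('o1, 'm1) cat \<Rightarrow> ('o2, 'm2) cat \<Rightarrow> ('o1, 'm1, 'o2, 'm2) fnctr \<Rightarrow> bool" where
  "bireflection D C G \<longleftrightarrow> is_functor D C G \<and>
     (\<exists>F \<eta>\<^sub>l \<epsilon>\<^sub>l \<eta>\<^sub>r \<epsilon>\<^sub>r. fully_faithful C D F \<and>
        adjunction C D F G \<eta>\<^sub>l \<epsilon>\<^sub>l \<and> adjunction D C G F \<eta>\<^sub>r \<epsilon>\<^sub>r \<and>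
        (\<forall>X \<in> Ob D. \<eta>\<^sub>r X \<cdot>\<^bsub>D\<^esub> \<epsilon>\<^sub>l X = Iden D (omap (F \<circ>\<^sub>F G) X)))"

definition equivalence ::
  "('o1, 'm1) cat \<Rightarrow> ('o2, 'm2) cat \<Rightarrow> ('o1, 'm1, 'o2, 'm2) fnctr \<Rightarrow> bool" where
  "equivalence D C G \<longleftrightarrow> is_functor D C G \<and>
     (\<exists>F \<alpha> \<beta>. is_functor C D F \<and>
        is_nat_iso D D id_fun (F \<circ>\<^sub>F G) \<alpha> \<and> is_nat_iso C C (G \<circ>\<^sub>F F) id_fun \<beta>)"


section \<open>Idempotent completion\<close>

definition is_idempotent :: "('o, 'm) cat \<Rightarrow> 'o \<Rightarrow> 'm \<Rightarrow> bool" where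
  "is_idempotent C X e \<longleftrightarrow> X \<in> Ob C \<and> e \<in> hom C X X \<and> e \<cdot>\<^bsub>C\<^esub> e = e"

definition idempotent_complete :: "('o, 'm) cat \<Rightarrow> bool" where
  "idempotent_complete C \<longleftrightarrow> category C \<and>
     (\<forall>X e. is_idempotent C X e \<longrightarrow>
        (\<exists>Y \<in> Ob C. \<exists>p \<in> hom C X Y. \<exists>i \<in> hom C Y X.
           e = i \<cdot>\<^bsub>C\<^esub> p \<and> p \<cdot>\<^bsub>C\<^esub> i = Iden C Y))"

text \<open>The same arrow \<open>f : X \<rightarrow> X'\<close> may be an arrow \<open>(X, e) \<rightarrow> (X', e')\<close> for several choices of
  \<open>e\<close> and \<open>e'\<close>; since \<^const>\<open>Dom\<close> and \<^const>\<open>Cod\<close> are functions of the arrow, arrows of the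
  completion are recorded as triples \<open>(source, f, target)\<close>.\<close>

type_synonym ('o, 'm) compl_ob = "'o \<times> 'm"
type_synonym ('o, 'm) compl_ar = "('o \<times> 'm) \<times> 'm \<times> ('o \<times> 'm)"

definition completion :: "('o, 'm) cat \<Rightarrow> (('o, 'm) compl_ob, ('o, 'm) compl_ar) cat" where
  "completion C =
     \<lparr>Ob = {(X, e). is_idempotent C X e},
      Ar = {((X, e), f, (X', e')). is_idempotent C X e \<and> is_idempotent C X' e' \<and>
              f \<in> hom C X X' \<and> f = e' \<cdot>\<^bsub>C\<^esub> f \<cdot>\<^bsub>C\<^esub> e},
      Dom = (\<lambda>(a, f, b). a),
      Cod = (\<lambda>(a, f, b). b),
      Iden = (\<lambda>(X, e). ((X, e), e, (X, e))),
      Comp = (\<lambda>(b', g, c) (a, f, b). (a, g \<cdot>\<^bsub>C\<^esub> f, c))\<rparr>"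

definition completion_fun ::
  "('o1, 'm1, 'o2, 'm2) fnctr \<Rightarrow>
   (('o1, 'm1) compl_ob, ('o1, 'm1) compl_ar, ('o2, 'm2) compl_ob, ('o2, 'm2) compl_ar) fnctr"
  where
  "completion_fun F =
     \<lparr>omap = (\<lambda>(X, e). (omap F X, amap F e)),
      amap = (\<lambda>((X, e), f, (X', e')).
                ((omap F X, amap F e), amap F f, (omap F X', amap F e')))\<rparr>"

lemma hom_completion:
  "hom (completion C) (X, e) (X', e') =
     {((X, e), f, (X', e')) | f. is_idempotent C X e \<and> is_idempotent C X' e' \<and>
        f \<in> hom C X X' \<and> f = e' \<cdot>\<^bsub>C\<^esub> f \<cdot>\<^bsub>C\<^esub> e}"
  unfolding hom_def[of "completion C"] by (auto simp: completion_def)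

lemma category_completion:
  assumes "category C"
  shows "category (completion C)"
proof -
  interpret category C by fact
  have l: "e' \<cdot>\<^bsub>C\<^esub> f = f" and r: "f \<cdot>\<^bsub>C\<^esub> e = f"
    if "is_idempotent C X e" "is_idempotent C X' e'" "f \<in> hom C X X'" "f = e' \<cdot>\<^bsub>C\<^esub> f \<cdot>\<^bsub>C\<^esub> e"
    for X e X' e' f
    using that unfolding is_idempotent_def by (metis Comp_assoc Comp_hom)+
  have c: "g \<cdot>\<^bsub>C\<^esub> f = e'' \<cdot>\<^bsub>C\<^esub> (g \<cdot>\<^bsub>C\<^esub> f) \<cdot>\<^bsub>C\<^esub> e"
    if "is_idempotent C X e" "is_idempotent C X' e'" "is_idempotent C X'' e''"
      "f \<in> hom C X X'" "f = e' \<cdot>\<^bsub>C\<^esub> f \<cdot>\<^bsub>C\<^esub> e" "g \<in> hom C X' X''" "g = e'' \<cdot>\<^bsub>C\<^esub> g \<cdot>\<^bsub>C\<^esub> e'"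
    for X e X' e' f X'' e'' g
  proof -
    have "e \<in> hom C X X" "e'' \<in> hom C X'' X''" using that by (auto simp: is_idempotent_def)
    then show ?thesis
      using that l[OF that(2,3,6,7)] r[OF that(1,2,4,5)] by (metis Comp_assoc Comp_hom)
  qed
  show ?thesis
  proof
    fix f assume "f \<in> Ar (completion C)"
    then show "Dom (completion C) f \<in> Ob (completion C)" "Cod (completion C) f \<in> Ob (completion C)"
      by (auto simp: completion_def)
  next
    fix X assume "X \<in> Ob (completion C)"
    then show "Iden (completion C) X \<in> hom (completion C) X X"
      unfolding hom_def[of "completion C"] by (auto simp: completion_def is_idempotent_def)
  next
    fix f X Y g Z assume "f \<in> hom (completion C) X Y" "g \<in> hom (completion C) Y Z"
    then show "g \<cdot>\<^bsub>completion C\<^esub> f \<in> hom (completion C) X Z"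
      using c Comp_hom by (cases X; cases Y; cases Z)
        (auto simp: hom_completion, auto simp: completion_def)
  next
    fix f X Y assume "f \<in> hom (completion C) X Y"
    then show "f \<cdot>\<^bsub>completion C\<^esub> Iden (completion C) X = f"
      "Iden (completion C) Y \<cdot>\<^bsub>completion C\<^esub> f = f"
      using l r by (cases X; cases Y; auto simp: hom_completion; auto simp: completion_def)+
  next
    fix f W X g Y h Z
    assume "f \<in> hom (completion C) W X" "g \<in> hom (completion C) X Y" "h \<in> hom (completion C) Y Z"
    then show "(h \<cdot>\<^bsub>completion C\<^esub> g) \<cdot>\<^bsub>completion C\<^esub> f = h \<cdot>\<^bsub>completion C\<^esub> g \<cdot>\<^bsub>completion C\<^esub> f"
      using Comp_assoc by (cases W; cases X; cases Y; cases Z)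
        (auto simp: hom_completion, auto simp: completion_def)
  qed
qed

lemma is_functor_completion_fun:
  assumes "is_functor A B F"
  shows "is_functor (completion A) (completion B) (completion_fun F)"
proof -
  interpret A: category A using assms by (simp add: is_functor_def)
  have o: "X \<in> Ob A" "Y \<in> Ob A" if "f \<in> hom A X Y" for f X Y
    using that A.Dom_Ob A.Cod_Ob by (auto simp: hom_def)
  have h: "amap F f \<in> hom B (omap F X) (omap F Y)" if "f \<in> hom A X Y" for f X Y
    using that o[OF that] assms by (auto simp: is_functor_def)
  have c: "amap F (g \<cdot>\<^bsub>A\<^esub> f) = amap F g \<cdot>\<^bsub>B\<^esub> amap F f"
    if "f \<in> hom A X Y" "g \<in> hom A Y Z" for f g X Y Z
    using that o[OF that(1)] o[OF that(2)] assms by (auto simp: is_functor_def)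
  have i: "is_idempotent B (omap F X) (amap F e)" if "is_idempotent A X e" for X e
    using that h[of e X X] c[of e X X e X] assms by (auto simp: is_idempotent_def is_functor_def)
  have m: "amap F f = amap F e' \<cdot>\<^bsub>B\<^esub> amap F f \<cdot>\<^bsub>B\<^esub> amap F e"
    if "is_idempotent A X e" "is_idempotent A Y e'" "f \<in> hom A X Y" "f = e' \<cdot>\<^bsub>A\<^esub> f \<cdot>\<^bsub>A\<^esub> e"
    for X e Y e' f
    using that c A.Comp_hom unfolding is_idempotent_def by metis
  show ?thesis
    unfolding is_functor_def
  proof (intro conjI ballI)
    show "category (completion A)" "category (completion B)"
      using assms category_completion by (auto simp: is_functor_def)
  next
    fix X assume "X \<in> Ob (completion A)"
    then show "omap (completion_fun F) X \<in> Ob (completion B)"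
      "amap (completion_fun F) (Iden (completion A) X) =
         Iden (completion B) (omap (completion_fun F) X)"
      using i by (auto simp: completion_def completion_fun_def)
  next
    fix X Y f assume "f \<in> hom (completion A) X Y"
    then show "amap (completion_fun F) f \<in>
        hom (completion B) (omap (completion_fun F) X) (omap (completion_fun F) Y)"
      using i h m by (cases X; cases Y) (auto simp: hom_completion completion_fun_def)
  next
    fix X Y Z f g assume "f \<in> hom (completion A) X Y" "g \<in> hom (completion A) Y Z"
    then show "amap (completion_fun F) (g \<cdot>\<^bsub>completion A\<^esub> f) =
        amap (completion_fun F) g \<cdot>\<^bsub>completion B\<^esub> amap (completion_fun F) f"
      using c by (cases X; cases Y; cases Z)
        (auto simp: hom_completion completion_fun_def, auto simp: completion_def)
  qed
qed


section \<open>Notions up to retracts\<close>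

definition reflection_upto_retracts ::
  "('o1, 'm1) cat \<Rightarrow> ('o2, 'm2) cat \<Rightarrow> ('o1, 'm1, 'o2, 'm2) fnctr \<Rightarrow> bool" where
  "reflection_upto_retracts D C G \<longleftrightarrow>
     reflection (completion D) (completion C) (completion_fun G)"

definition coreflection_upto_retracts ::
  "('o1, 'm1) cat \<Rightarrow> ('o2, 'm2) cat \<Rightarrow> ('o1, 'm1, 'o2, 'm2) fnctr \<Rightarrow> bool" where
  "coreflection_upto_retracts D C G \<longleftrightarrow>
     coreflection (completion D) (completion C) (completion_fun G)"

definition bireflection_upto_retracts ::
  "('o1, 'm1) cat \<Rightarrow> ('o2, 'm2) cat \<Rightarrow> ('o1, 'm1, 'o2, 'm2) fnctr \<Rightarrow> bool" where
  "bireflection_upto_retracts D C G \<longleftrightarrow>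
     bireflection (completion D) (completion C) (completion_fun G)"

definition equivalence_upto_retracts ::
  "('o1, 'm1) cat \<Rightarrow> ('o2, 'm2) cat \<Rightarrow> ('o1, 'm1, 'o2, 'm2) fnctr \<Rightarrow> bool" where
  "equivalence_upto_retracts D C G \<longleftrightarrow>
     equivalence (completion D) (completion C) (completion_fun G)"

end

theory Submission
  imports Defs
begin

text \<open>Adjunctions, full faithfulness and natural isomorphisms are preserved by idempotent
  completion, which gives one direction. Conversely, the embedding of \<open>C\<close> into its completion is
  fully faithful, and that of \<open>D\<close> is moreover essentially surjective, because \<open>D\<close> is idempotent
  complete: a splitting of \<open>e\<close> is an isomorphism between \<open>(X, e)\<close> and an object \<open>(Y, Id)\<close>. An
  adjoint or quasi-inverse of the completed functor can therefore be replaced by an isomorphic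
  functor that maps the image of \<open>C\<close> strictly into the image of \<open>D\<close>; all the data then restrict
  along the two embeddings, and the required equations hold because they hold after applying a
  faithful functor.\<close>

section \<open>Categories, functors and natural transformations\<close>

text \<open>A quasi-inverse or adjoint of the completed functor may send \<open>(X, Id)\<close> to a
  pair \<open>(Y, e)\<close> whose idempotent \<open>e\<close> is not an identity, so it need not
  restrict to the original categories as it stands. Passing to an isomorphic functor is harmless for
  the existence of an adjunction, but a bireflection also imposes an equation between a unit and a
  counit. This is why units and counits are transported by explicit formulas: an isomorphism
  \<sigma> with inverse \<tau> contributes \<sigma> on the left of one and \<tau> on the right of
  the other, so the new composite is the old one conjugated, and a conjugated identity is an
  identity. Only values in the completion of \<open>D\<close> have to be moved, and this is where
  splittings in \<open>D\<close> suffice; the completed \<open>G\<close> already respects the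
  embeddings strictly. For the passage to completions the point is that \<open>Id\<close> of
  \<open>(X, e)\<close> is \<open>e\<close>. A component \<tau> at \<open>X\<close> must therefore
  be cut down by the idempotent, and each equation between components becomes the old equation
  multiplied by an idempotent.\<close>

context category
begin

lemma hom_Ob: "f \<in> hom C X Y \<Longrightarrow> X \<in> Ob C" "f \<in> hom C X Y \<Longrightarrow> Y \<in> Ob C"
  using Dom_Ob Cod_Ob by (auto simp: hom_def)

lemma Ar_hom: "f \<in> Ar C \<Longrightarrow> f \<in> hom C (Dom C f) (Cod C f)"
  by (simp add: hom_def)

text \<open>Unlike \<open>Comp_assoc\<close> and its companions, these are usable as conditional rewrite rules: all
  variables of their premises occur in the rewritten term.\<close>

lemma Ar_simps:
  "X \<in> Ob C \<Longrightarrow> Iden C X \<in> Ar C" "X \<in> Ob C \<Longrightarrow> Dom C (Iden C X) = X"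
  "X \<in> Ob C \<Longrightarrow> Cod C (Iden C X) = X"
  "f \<in> Ar C \<Longrightarrow> g \<in> Ar C \<Longrightarrow> Cod C f = Dom C g \<Longrightarrow> g \<cdot> f \<in> Ar C"
  "f \<in> Ar C \<Longrightarrow> g \<in> Ar C \<Longrightarrow> Cod C f = Dom C g \<Longrightarrow> Dom C (g \<cdot> f) = Dom C f"
  "f \<in> Ar C \<Longrightarrow> g \<in> Ar C \<Longrightarrow> Cod C f = Dom C g \<Longrightarrow> Cod C (g \<cdot> f) = Cod C g"
  "f \<in> Ar C \<Longrightarrow> g \<in> Ar C \<Longrightarrow> h \<in> Ar C \<Longrightarrow> Cod C f = Dom C g \<Longrightarrow> Cod C g = Dom C h \<Longrightarrow>
     (h \<cdot> g) \<cdot> f = h \<cdot> (g \<cdot> f)"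
  "f \<in> Ar C \<Longrightarrow> Dom C f = X \<Longrightarrow> f \<cdot> Iden C X = f"
  "f \<in> Ar C \<Longrightarrow> Cod C f = X \<Longrightarrow> Iden C X \<cdot> f = f"
proof -
  show "X \<in> Ob C \<Longrightarrow> Iden C X \<in> Ar C" "X \<in> Ob C \<Longrightarrow> Dom C (Iden C X) = X"
    "X \<in> Ob C \<Longrightarrow> Cod C (Iden C X) = X"
    using Id_hom[of X] by (auto simp: hom_def)
  show "g \<cdot> f \<in> Ar C" "Dom C (g \<cdot> f) = Dom C f" "Cod C (g \<cdot> f) = Cod C g"
    if "f \<in> Ar C" "g \<in> Ar C" "Cod C f = Dom C g"
    using Comp_hom[of f "Dom C f" "Cod C f" g "Cod C g"] that by (simp_all add: hom_def)
  show "(h \<cdot> g) \<cdot> f = h \<cdot> (g \<cdot> f)"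
    if "f \<in> Ar C" "g \<in> Ar C" "h \<in> Ar C" "Cod C f = Dom C g" "Cod C g = Dom C h"
    using Comp_assoc[of f "Dom C f" "Cod C f" g "Cod C g" h "Cod C h"] that by (simp add: hom_def)
  show "f \<in> Ar C \<Longrightarrow> Dom C f = X \<Longrightarrow> f \<cdot> Iden C X = f"
    "f \<in> Ar C \<Longrightarrow> Cod C f = X \<Longrightarrow> Iden C X \<cdot> f = f"
    using Comp_Id[of f X "Cod C f"] Id_Comp[of f "Dom C f" X] by (simp_all add: hom_def)
qed

text \<open>Composites are kept nested to the right, so a one-sided inverse usually has to be
  cancelled in front of a further factor \<open>h\<close>.\<close>

lemma Comp_cancel_mid:
  assumes "f \<in> hom C W X" "g \<in> hom C X Y" "g \<cdot> f = Iden C W" "Y = W"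
    and "h \<in> hom C V W"
  shows "g \<cdot> (f \<cdot> h) = h"
  using assms Comp_assoc Id_Comp by metis

end

text \<open>The definition quantifies over objects as well as arrows; the object premises disappear
  here because the ends of an arrow are objects of the source category.\<close>

lemma is_functorD:
  assumes "is_functor A B F"
  shows functor_category: "category A" "category B"
    and functor_Ob: "X \<in> Ob A \<Longrightarrow> omap F X \<in> Ob B"
    and functor_hom: "f \<in> hom A X Y \<Longrightarrow> amap F f \<in> hom B (omap F X) (omap F Y)"
    and functor_Id: "X \<in> Ob A \<Longrightarrow> amap F (Iden A X) = Iden B (omap F X)"
    and functor_Comp: "f \<in> hom A X Y \<Longrightarrow> g \<in> hom A Y Z \<Longrightarrow>
      amap F (g \<cdot>\<^bsub>A\<^esub> f) = amap F g \<cdot>\<^bsub>B\<^esub> amap F f"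
  using assms category.hom_Ob[of A] unfolding is_functor_def by meson+

lemma is_functorI:
  assumes "category A" "category B"
    and "\<And>X. X \<in> Ob A \<Longrightarrow> omap F X \<in> Ob B"
    and "\<And>X Y f. f \<in> hom A X Y \<Longrightarrow> amap F f \<in> hom B (omap F X) (omap F Y)"
    and "\<And>X. X \<in> Ob A \<Longrightarrow> amap F (Iden A X) = Iden B (omap F X)"
    and "\<And>X Y Z f g. f \<in> hom A X Y \<Longrightarrow> g \<in> hom A Y Z \<Longrightarrow>
      amap F (g \<cdot>\<^bsub>A\<^esub> f) = amap F g \<cdot>\<^bsub>B\<^esub> amap F f"
  shows "is_functor A B F"
  using assms unfolding is_functor_def by blast

lemma is_functor_id: "category A \<Longrightarrow> is_functor A A id_fun"
  by (rule is_functorI) (auto simp: id_fun_def)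

lemma is_functor_comp:
  assumes F: "is_functor A B F" and G: "is_functor B C G"
  shows "is_functor A C (G \<circ>\<^sub>F F)"
proof (rule is_functorI)
  show "amap (G \<circ>\<^sub>F F) (g \<cdot>\<^bsub>A\<^esub> f) = amap (G \<circ>\<^sub>F F) g \<cdot>\<^bsub>C\<^esub> amap (G \<circ>\<^sub>F F) f"
    if "f \<in> hom A X Y" "g \<in> hom A Y Z" for X Y Z f g
    using functor_Comp[OF G functor_hom[OF F that(1)] functor_hom[OF F that(2)]]
      functor_Comp[OF F that] by (simp add: comp_fun_def)
qed (use is_functorD[OF F] is_functorD[OF G] in \<open>auto simp: comp_fun_def\<close>)

lemma fun_simps:
  "omap id_fun X = X" "amap id_fun f = f"
  "omap (G \<circ>\<^sub>F F) Y = omap G (omap F Y)" "amap (G \<circ>\<^sub>F F) g = amap G (amap F g)"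
  by (simp_all add: id_fun_def comp_fun_def)

lemma is_nat_transD:
  assumes "is_nat_trans A B F G \<tau>"
  shows nat_functor: "is_functor A B F" "is_functor A B G"
    and nat_hom: "X \<in> Ob A \<Longrightarrow> \<tau> X \<in> hom B (omap F X) (omap G X)"
    and nat_square: "f \<in> hom A X Y \<Longrightarrow> \<tau> Y \<cdot>\<^bsub>B\<^esub> amap F f = amap G f \<cdot>\<^bsub>B\<^esub> \<tau> X"
  using assms category.hom_Ob[of A] unfolding is_nat_trans_def is_functor_def by meson+

lemma is_nat_transI:
  assumes "is_functor A B F" "is_functor A B G"
    and "\<And>X. X \<in> Ob A \<Longrightarrow> \<tau> X \<in> hom B (omap F X) (omap G X)"
    and "\<And>X Y f. f \<in> hom A X Y \<Longrightarrow> \<tau> Y \<cdot>\<^bsub>B\<^esub> amap F f = amap G f \<cdot>\<^bsub>B\<^esub> \<tau> X"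
  shows "is_nat_trans A B F G \<tau>"
  using assms unfolding is_nat_trans_def by blast

lemma nat_trans_comp:
  assumes s: "is_nat_trans A B F G \<sigma>" and t: "is_nat_trans A B G H \<tau>"
  shows "is_nat_trans A B F H (\<lambda>X. \<tau> X \<cdot>\<^bsub>B\<^esub> \<sigma> X)"
proof -
  note sD = is_nat_transD[OF s] and tD = is_nat_transD[OF t]
  interpret A: category A using sD(1) by (rule is_functorD)
  interpret B: category B using sD(1) by (rule is_functorD)
  show ?thesis
  proof (rule is_nat_transI)
    show "(\<tau> Y \<cdot>\<^bsub>B\<^esub> \<sigma> Y) \<cdot>\<^bsub>B\<^esub> amap F f = amap H f \<cdot>\<^bsub>B\<^esub> \<tau> X \<cdot>\<^bsub>B\<^esub> \<sigma> X"
      if f: "f \<in> hom A X Y" for X Y f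
    proof -
      note o = A.hom_Ob[OF f]
      note h = sD(3)[OF o(1)] sD(3)[OF o(2)] tD(3)[OF o(1)] tD(3)[OF o(2)]
        functor_hom[OF sD(1) f] functor_hom[OF sD(2) f] functor_hom[OF tD(2) f]
      show ?thesis
        using sD(4)[OF f] tD(4)[OF f] B.Comp_assoc[OF h(5,2,4)] B.Comp_assoc[OF h(1,6,4)]
          B.Comp_assoc[OF h(1,3,7)] by simp
    qed
  qed (use sD tD B.Comp_hom in blast)+
qed

lemma nat_trans_whisker_left:
  assumes s: "is_nat_trans A B F G \<sigma>" and H: "is_functor B C H"
  shows "is_nat_trans A C (H \<circ>\<^sub>F F) (H \<circ>\<^sub>F G) (\<lambda>X. amap H (\<sigma> X))"
proof -
  note sD = is_nat_transD[OF s]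
  interpret A: category A using sD(1) by (rule is_functorD)
  show ?thesis
  proof (rule is_nat_transI)
    show "amap H (\<sigma> Y) \<cdot>\<^bsub>C\<^esub> amap (H \<circ>\<^sub>F F) f = amap (H \<circ>\<^sub>F G) f \<cdot>\<^bsub>C\<^esub> amap H (\<sigma> X)"
      if f: "f \<in> hom A X Y" for X Y f
      using sD(4)[OF f] functor_Comp[OF H] functor_hom[OF sD(1) f] functor_hom[OF sD(2) f]
        sD(3) A.hom_Ob[OF f] unfolding fun_simps by metis
  qed (use sD H in \<open>auto intro: is_functor_comp functor_hom simp: fun_simps\<close>)
qed

lemma nat_trans_whisker_right:
  assumes s: "is_nat_trans B C F G \<sigma>" and H: "is_functor A B H"
  shows "is_nat_trans A C (F \<circ>\<^sub>F H) (G \<circ>\<^sub>F H) (\<lambda>X. \<sigma> (omap H X))"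
  using is_nat_transD[OF s] is_functorD[OF H] H
  by (intro is_nat_transI) (auto intro: is_functor_comp simp: fun_simps)

section \<open>Natural isomorphisms and their inverses\<close>

lemma is_nat_isoD:
  assumes "is_nat_iso A B F G \<tau>"
  shows "is_nat_trans A B F G \<tau>" "X \<in> Ob A \<Longrightarrow> is_iso B (omap F X) (omap G X) (\<tau> X)"
  using assms unfolding is_nat_iso_def by auto

text \<open>\<open>is_iso\<close> hides each inverse behind an existential quantifier. Choosing the
  inverses gives one family, and its naturality squares are those of \<sigma> conjugated.\<close>

lemma nat_isoE:
  assumes s: "is_nat_iso A B F G \<sigma>"
  obtains \<tau> where "is_nat_trans A B F G \<sigma>" "is_nat_trans A B G F \<tau>"
    "\<And>X. X \<in> Ob A \<Longrightarrow> \<tau> X \<cdot>\<^bsub>B\<^esub> \<sigma> X = Iden B (omap F X)"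
    "\<And>X. X \<in> Ob A \<Longrightarrow> \<sigma> X \<cdot>\<^bsub>B\<^esub> \<tau> X = Iden B (omap G X)"
proof -
  note st = is_nat_isoD(1)[OF s]
  note sD = is_nat_transD[OF st]
  interpret A: category A using sD(1) by (rule is_functorD)
  interpret B: category B using sD(1) by (rule is_functorD)
  have "\<forall>X\<in>Ob A. \<exists>g. g \<in> hom B (omap G X) (omap F X) \<and> g \<cdot>\<^bsub>B\<^esub> \<sigma> X = Iden B (omap F X) \<and>
      \<sigma> X \<cdot>\<^bsub>B\<^esub> g = Iden B (omap G X)"
    using is_nat_isoD(2)[OF s] unfolding is_iso_def by blast
  then obtain \<tau> where t: "\<tau> X \<in> hom B (omap G X) (omap F X)"
    "\<tau> X \<cdot>\<^bsub>B\<^esub> \<sigma> X = Iden B (omap F X)" "\<sigma> X \<cdot>\<^bsub>B\<^esub> \<tau> X = Iden B (omap G X)" if "X \<in> Ob A" for X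
    using bchoice by metis
  have "is_nat_trans A B G F \<tau>"
  proof (rule is_nat_transI)
    show "\<tau> Y \<cdot>\<^bsub>B\<^esub> amap G f = amap F f \<cdot>\<^bsub>B\<^esub> \<tau> X" if f: "f \<in> hom A X Y" for X Y f
    proof -
      note o = A.hom_Ob[OF f]
      note h = functor_hom[OF sD(1) f] functor_hom[OF sD(2) f] sD(3)[OF o(1)] sD(3)[OF o(2)]
        t(1)[OF o(1)] t(1)[OF o(2)]
      \<comment> \<open>An identity, written as \<sigma> after \<tau> at \<open>X\<close>, is
        inserted so that naturality of \<sigma> can trade \<open>G f\<close> for
        \<open>F f\<close>.\<close>
      have "\<tau> Y \<cdot>\<^bsub>B\<^esub> amap G f = \<tau> Y \<cdot>\<^bsub>B\<^esub> (amap G f \<cdot>\<^bsub>B\<^esub> \<sigma> X) \<cdot>\<^bsub>B\<^esub> \<tau> X"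
        using h t(3)[OF o(1)] B.Comp_assoc B.Comp_Id by metis
      also have "\<dots> = \<tau> Y \<cdot>\<^bsub>B\<^esub> (\<sigma> Y \<cdot>\<^bsub>B\<^esub> amap F f) \<cdot>\<^bsub>B\<^esub> \<tau> X"
        using sD(4)[OF f] by simp
      also have "\<dots> = amap F f \<cdot>\<^bsub>B\<^esub> \<tau> X"
        using B.Comp_assoc[OF h(5,1,4)]
          B.Comp_cancel_mid[OF h(4,6) t(2)[OF o(2)] refl B.Comp_hom[OF h(5,1)]] by simp
      finally show ?thesis .
    qed
  qed (use sD t in auto)
  then show ?thesis using st t that by blast
qed

lemma nat_isoI:
  assumes s: "is_nat_trans A B F G \<sigma>" and t: "is_nat_trans A B G F \<tau>"
    and "\<And>X. X \<in> Ob A \<Longrightarrow> \<tau> X \<cdot>\<^bsub>B\<^esub> \<sigma> X = Iden B (omap F X)"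
    and "\<And>X. X \<in> Ob A \<Longrightarrow> \<sigma> X \<cdot>\<^bsub>B\<^esub> \<tau> X = Iden B (omap G X)"
  shows "is_nat_iso A B F G \<sigma>"
  using assms is_nat_transD(3)[OF s] is_nat_transD(3)[OF t]
  unfolding is_nat_iso_def is_iso_def by blast

lemma nat_iso_inverse:
  assumes "is_nat_iso A B F G \<sigma>"
  obtains \<tau> where "is_nat_iso A B G F \<tau>"
  using nat_isoE[OF assms] nat_isoI by metis

lemma nat_iso_comp:
  assumes s: "is_nat_iso A B F G \<sigma>" and t: "is_nat_iso A B G H \<tau>"
  shows "is_nat_iso A B F H (\<lambda>X. \<tau> X \<cdot>\<^bsub>B\<^esub> \<sigma> X)"
proof -
  obtain s' where s': "is_nat_trans A B F G \<sigma>" "is_nat_trans A B G F s'"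
    "\<And>X. X \<in> Ob A \<Longrightarrow> s' X \<cdot>\<^bsub>B\<^esub> \<sigma> X = Iden B (omap F X)"
    "\<And>X. X \<in> Ob A \<Longrightarrow> \<sigma> X \<cdot>\<^bsub>B\<^esub> s' X = Iden B (omap G X)"
    by (rule nat_isoE[OF s]) (rule that; blast)
  obtain t' where t': "is_nat_trans A B G H \<tau>" "is_nat_trans A B H G t'"
    "\<And>X. X \<in> Ob A \<Longrightarrow> t' X \<cdot>\<^bsub>B\<^esub> \<tau> X = Iden B (omap G X)"
    "\<And>X. X \<in> Ob A \<Longrightarrow> \<tau> X \<cdot>\<^bsub>B\<^esub> t' X = Iden B (omap H X)"
    by (rule nat_isoE[OF t]) (rule that; blast)
  interpret B: category B using nat_functor(1)[OF s'(1)] by (rule is_functorD)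
  show ?thesis
  proof (rule nat_isoI[OF nat_trans_comp[OF s'(1) t'(1)] nat_trans_comp[OF t'(2) s'(2)]])
    fix X assume X: "X \<in> Ob A"
    note h = nat_hom[OF s'(1) X] nat_hom[OF s'(2) X] nat_hom[OF t'(1) X] nat_hom[OF t'(2) X]
    show "(s' X \<cdot>\<^bsub>B\<^esub> t' X) \<cdot>\<^bsub>B\<^esub> \<tau> X \<cdot>\<^bsub>B\<^esub> \<sigma> X = Iden B (omap F X)"
      using s'(3)[OF X] B.Comp_assoc[OF B.Comp_hom[OF h(1,3)] h(4,2)]
        B.Comp_cancel_mid[OF h(3,4) t'(3)[OF X] refl h(1)] by simp
    show "(\<tau> X \<cdot>\<^bsub>B\<^esub> \<sigma> X) \<cdot>\<^bsub>B\<^esub> s' X \<cdot>\<^bsub>B\<^esub> t' X = Iden B (omap H X)"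
      using t'(4)[OF X] B.Comp_assoc[OF B.Comp_hom[OF h(4,2)] h(1,3)]
        B.Comp_cancel_mid[OF h(2,1) s'(4)[OF X] refl h(4)] by simp
  qed
qed

lemma nat_iso_whisker_left:
  assumes s: "is_nat_iso A B F G \<sigma>" and H: "is_functor B C H"
  shows "is_nat_iso A C (H \<circ>\<^sub>F F) (H \<circ>\<^sub>F G) (\<lambda>X. amap H (\<sigma> X))"
proof -
  obtain \<tau> where t: "is_nat_trans A B F G \<sigma>" "is_nat_trans A B G F \<tau>"
    "\<And>X. X \<in> Ob A \<Longrightarrow> \<tau> X \<cdot>\<^bsub>B\<^esub> \<sigma> X = Iden B (omap F X)"
    "\<And>X. X \<in> Ob A \<Longrightarrow> \<sigma> X \<cdot>\<^bsub>B\<^esub> \<tau> X = Iden B (omap G X)"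
    by (rule nat_isoE[OF s]) (rule that; blast)
  note o = functor_Ob[OF nat_functor(1)[OF t(1)]] functor_Ob[OF nat_functor(2)[OF t(1)]]
  show ?thesis
  proof (rule nat_isoI[OF nat_trans_whisker_left[OF t(1) H] nat_trans_whisker_left[OF t(2) H]])
    fix X assume X: "X \<in> Ob A"
    show "amap H (\<tau> X) \<cdot>\<^bsub>C\<^esub> amap H (\<sigma> X) = Iden C (omap (H \<circ>\<^sub>F F) X)"
      "amap H (\<sigma> X) \<cdot>\<^bsub>C\<^esub> amap H (\<tau> X) = Iden C (omap (H \<circ>\<^sub>F G) X)"
      using t(3,4)[OF X] functor_Comp[OF H nat_hom[OF t(1) X] nat_hom[OF t(2) X]]
        functor_Comp[OF H nat_hom[OF t(2) X] nat_hom[OF t(1) X]]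
        functor_Id[OF H] o[OF X] by (simp_all add: fun_simps)
  qed
qed

lemma nat_iso_whisker_right:
  assumes s: "is_nat_iso B C F G \<sigma>" and H: "is_functor A B H"
  shows "is_nat_iso A C (F \<circ>\<^sub>F H) (G \<circ>\<^sub>F H) (\<lambda>X. \<sigma> (omap H X))"
  using nat_trans_whisker_right[OF is_nat_isoD(1)[OF s] H] is_nat_isoD(2)[OF s] functor_Ob[OF H]
  by (simp add: is_nat_iso_def fun_simps)


section \<open>Transport along natural isomorphisms\<close>

lemma adjunctionD:
  assumes "adjunction A B L R \<eta> \<epsilon>"
  shows "is_functor A B L" "is_functor B A R"
    "is_nat_trans A A id_fun (R \<circ>\<^sub>F L) \<eta>" "is_nat_trans B B (L \<circ>\<^sub>F R) id_fun \<epsilon>"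
    "X \<in> Ob A \<Longrightarrow> \<epsilon> (omap L X) \<cdot>\<^bsub>B\<^esub> amap L (\<eta> X) = Iden B (omap L X)"
    "Y \<in> Ob B \<Longrightarrow> amap R (\<epsilon> Y) \<cdot>\<^bsub>A\<^esub> \<eta> (omap R Y) = Iden A (omap R Y)"
  using assms unfolding adjunction_def by auto

text \<open>In the first triangle, naturality of \<tau> moves \<tau> to the right end and naturality
  of \<epsilon> moves \<sigma> to the left end; the old triangle collapses between them and leaves
  \<sigma> after \<tau>. In the second, the images of \<tau> and \<sigma> under \<open>R\<close>
  meet and cancel. The new unit and counit are spelled out because the bireflection equation is
  about them.\<close>

lemma adjunction_transport_left:
  assumes adj: "adjunction A B L R \<eta> \<epsilon>"
    and s: "is_nat_trans A B L K \<sigma>" and t: "is_nat_trans A B K L \<tau>"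
    and ts: "\<And>X. X \<in> Ob A \<Longrightarrow> \<tau> X \<cdot>\<^bsub>B\<^esub> \<sigma> X = Iden B (omap L X)"
    and st: "\<And>X. X \<in> Ob A \<Longrightarrow> \<sigma> X \<cdot>\<^bsub>B\<^esub> \<tau> X = Iden B (omap K X)"
  shows "adjunction A B K R (\<lambda>X. amap R (\<sigma> X) \<cdot>\<^bsub>A\<^esub> \<eta> X) (\<lambda>Y. \<epsilon> Y \<cdot>\<^bsub>B\<^esub> \<tau> (omap R Y))"
proof -
  note L = adjunctionD(1)[OF adj] and R = adjunctionD(2)[OF adj] and
    \<eta> = adjunctionD(3)[OF adj] and \<epsilon> = adjunctionD(4)[OF adj] and
    tri1 = adjunctionD(5)[OF adj] and tri2 = adjunctionD(6)[OF adj]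
  note K = nat_functor(2)[OF s]
  interpret A: category A using L by (rule is_functorD)
  interpret B: category B using L by (rule is_functorD)
  have "(\<epsilon> (omap K X) \<cdot>\<^bsub>B\<^esub> \<tau> (omap R (omap K X))) \<cdot>\<^bsub>B\<^esub> amap K (amap R (\<sigma> X) \<cdot>\<^bsub>A\<^esub> \<eta> X)
      = Iden B (omap K X)" if X: "X \<in> Ob A" for X
  proof -
    let ?g = "amap R (\<sigma> X) \<cdot>\<^bsub>A\<^esub> \<eta> X"
    note KX = functor_Ob[OF K X]
    note sX = nat_hom[OF s X] and tX = nat_hom[OF t X]
    note RsX = functor_hom[OF R sX]
    note eX = nat_hom[OF \<eta> X, unfolded fun_simps]
    have g: "?g \<in> hom A X (omap R (omap K X))" using A.Comp_hom eX RsX .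
    note tRK = nat_hom[OF t functor_Ob[OF R KX]]
    note eK = nat_hom[OF \<epsilon> KX, unfolded fun_simps]
    note eL = nat_hom[OF \<epsilon> functor_Ob[OF L X], unfolded fun_simps]
    note LRs = functor_hom[OF L RsX] and Le = functor_hom[OF L eX]
    have "(\<epsilon> (omap K X) \<cdot>\<^bsub>B\<^esub> \<tau> (omap R (omap K X))) \<cdot>\<^bsub>B\<^esub> amap K ?g
        = \<epsilon> (omap K X) \<cdot>\<^bsub>B\<^esub> (\<tau> (omap R (omap K X)) \<cdot>\<^bsub>B\<^esub> amap K ?g)"
      using B.Comp_assoc[OF functor_hom[OF K g] tRK eK] .
    also have "\<dots> = \<epsilon> (omap K X) \<cdot>\<^bsub>B\<^esub> (amap L ?g \<cdot>\<^bsub>B\<^esub> \<tau> X)"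
      using nat_square[OF t g] by simp
    also have "\<dots> = ((\<epsilon> (omap K X) \<cdot>\<^bsub>B\<^esub> amap L (amap R (\<sigma> X))) \<cdot>\<^bsub>B\<^esub> amap L (\<eta> X)) \<cdot>\<^bsub>B\<^esub> \<tau> X"
      using functor_Comp[OF L eX RsX] eK LRs Le tX by (simp add: hom_def B.Ar_simps)
    also have "\<dots> = ((\<sigma> X \<cdot>\<^bsub>B\<^esub> \<epsilon> (omap L X)) \<cdot>\<^bsub>B\<^esub> amap L (\<eta> X)) \<cdot>\<^bsub>B\<^esub> \<tau> X"
      using nat_square[OF \<epsilon> sX] by (simp add: fun_simps)
    also have "\<dots> = \<sigma> X \<cdot>\<^bsub>B\<^esub> \<tau> X"
      using tri1[OF X] B.Comp_assoc[OF Le eL sX] B.Comp_Id[OF sX] by simp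
    finally show ?thesis using st[OF X] by simp
  qed
  moreover have "amap R (\<epsilon> Y \<cdot>\<^bsub>B\<^esub> \<tau> (omap R Y)) \<cdot>\<^bsub>A\<^esub> (amap R (\<sigma> (omap R Y)) \<cdot>\<^bsub>A\<^esub> \<eta> (omap R Y))
      = Iden A (omap R Y)" if Y: "Y \<in> Ob B" for Y
  proof -
    note RY = functor_Ob[OF R Y]
    note sY = nat_hom[OF s RY] and tY = nat_hom[OF t RY]
    note h = nat_hom[OF \<eta> RY, unfolded fun_simps] and e = nat_hom[OF \<epsilon> Y, unfolded fun_simps]
    have "amap R (\<tau> (omap R Y)) \<cdot>\<^bsub>A\<^esub> amap R (\<sigma> (omap R Y)) = Iden A (omap R (omap L (omap R Y)))"
      using functor_Comp[OF R sY tY] ts[OF RY] functor_Id[OF R functor_Ob[OF L RY]] by simp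
    then have "amap R (\<tau> (omap R Y)) \<cdot>\<^bsub>A\<^esub> (amap R (\<sigma> (omap R Y)) \<cdot>\<^bsub>A\<^esub> \<eta> (omap R Y)) = \<eta> (omap R Y)"
      using A.Comp_assoc[OF h functor_hom[OF R sY] functor_hom[OF R tY]] A.Id_Comp[OF h] by simp
    then show ?thesis
      using tri2[OF Y] functor_Comp[OF R tY e]
        A.Comp_assoc[OF A.Comp_hom[OF h functor_hom[OF R sY]] functor_hom[OF R tY]
          functor_hom[OF R e]] by simp
  qed
  ultimately show ?thesis
    using K R nat_trans_comp[OF \<eta> nat_trans_whisker_left[OF s R]]
      nat_trans_comp[OF nat_trans_whisker_right[OF t R] \<epsilon>]
    unfolding adjunction_def by blast
qed

text \<open>The mirror image for the right adjoint: now naturality of \<sigma> carries \<sigma> to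
  the left end and naturality of \<eta> carries \<tau> to the right end, around the second
  triangle.\<close>

lemma adjunction_transport_right:
  assumes adj: "adjunction A B L R \<eta> \<epsilon>"
    and s: "is_nat_trans B A R K \<sigma>" and t: "is_nat_trans B A K R \<tau>"
    and ts: "\<And>Y. Y \<in> Ob B \<Longrightarrow> \<tau> Y \<cdot>\<^bsub>A\<^esub> \<sigma> Y = Iden A (omap R Y)"
    and st: "\<And>Y. Y \<in> Ob B \<Longrightarrow> \<sigma> Y \<cdot>\<^bsub>A\<^esub> \<tau> Y = Iden A (omap K Y)"
  shows "adjunction A B L K (\<lambda>X. \<sigma> (omap L X) \<cdot>\<^bsub>A\<^esub> \<eta> X) (\<lambda>Y. \<epsilon> Y \<cdot>\<^bsub>B\<^esub> amap L (\<tau> Y))"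
proof -
  note L = adjunctionD(1)[OF adj] and R = adjunctionD(2)[OF adj] and
    \<eta> = adjunctionD(3)[OF adj] and \<epsilon> = adjunctionD(4)[OF adj] and
    tri1 = adjunctionD(5)[OF adj] and tri2 = adjunctionD(6)[OF adj]
  note K = nat_functor(2)[OF s]
  interpret A: category A using L by (rule is_functorD)
  interpret B: category B using L by (rule is_functorD)
  have "amap K (\<epsilon> Y \<cdot>\<^bsub>B\<^esub> amap L (\<tau> Y)) \<cdot>\<^bsub>A\<^esub> (\<sigma> (omap L (omap K Y)) \<cdot>\<^bsub>A\<^esub> \<eta> (omap K Y))
      = Iden A (omap K Y)" if Y: "Y \<in> Ob B" for Y
  proof -
    let ?g = "\<epsilon> Y \<cdot>\<^bsub>B\<^esub> amap L (\<tau> Y)"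
    note KY = functor_Ob[OF K Y]
    note sY = nat_hom[OF s Y] and tY = nat_hom[OF t Y]
    note LtY = functor_hom[OF L tY]
    note eY = nat_hom[OF \<epsilon> Y, unfolded fun_simps]
    have g: "?g \<in> hom B (omap L (omap K Y)) Y" using B.Comp_hom LtY eY .
    note sLK = nat_hom[OF s functor_Ob[OF L KY]]
    note hK = nat_hom[OF \<eta> KY, unfolded fun_simps]
    note hR = nat_hom[OF \<eta> functor_Ob[OF R Y], unfolded fun_simps]
    note RLt = functor_hom[OF R LtY] and Re = functor_hom[OF R eY]
    have "amap K ?g \<cdot>\<^bsub>A\<^esub> (\<sigma> (omap L (omap K Y)) \<cdot>\<^bsub>A\<^esub> \<eta> (omap K Y))
        = (amap K ?g \<cdot>\<^bsub>A\<^esub> \<sigma> (omap L (omap K Y))) \<cdot>\<^bsub>A\<^esub> \<eta> (omap K Y)"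
      using A.Comp_assoc[OF hK sLK functor_hom[OF K g]] by simp
    also have "\<dots> = (\<sigma> Y \<cdot>\<^bsub>A\<^esub> amap R ?g) \<cdot>\<^bsub>A\<^esub> \<eta> (omap K Y)"
      using nat_square[OF s g] by simp
    also have "\<dots> = \<sigma> Y \<cdot>\<^bsub>A\<^esub> (amap R (\<epsilon> Y) \<cdot>\<^bsub>A\<^esub> (amap R (amap L (\<tau> Y)) \<cdot>\<^bsub>A\<^esub> \<eta> (omap K Y)))"
      using functor_Comp[OF R LtY eY] hK RLt Re sY by (simp add: hom_def A.Ar_simps)
    also have "\<dots> = \<sigma> Y \<cdot>\<^bsub>A\<^esub> (amap R (\<epsilon> Y) \<cdot>\<^bsub>A\<^esub> (\<eta> (omap R Y) \<cdot>\<^bsub>A\<^esub> \<tau> Y))"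
      using nat_square[OF \<eta> tY] by (simp add: fun_simps)
    also have "\<dots> = \<sigma> Y \<cdot>\<^bsub>A\<^esub> \<tau> Y"
      using tri2[OF Y] A.Comp_assoc[OF tY hR Re] A.Id_Comp[OF tY] by simp
    finally show ?thesis using st[OF Y] by simp
  qed
  moreover have "(\<epsilon> (omap L X) \<cdot>\<^bsub>B\<^esub> amap L (\<tau> (omap L X))) \<cdot>\<^bsub>B\<^esub> amap L (\<sigma> (omap L X) \<cdot>\<^bsub>A\<^esub> \<eta> X)
      = Iden B (omap L X)" if X: "X \<in> Ob A" for X
  proof -
    note LX = functor_Ob[OF L X]
    note sX = nat_hom[OF s LX] and tX = nat_hom[OF t LX]
    note h = nat_hom[OF \<eta> X, unfolded fun_simps] and e = nat_hom[OF \<epsilon> LX, unfolded fun_simps]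
    note sh = A.Comp_hom[OF h sX]
    have "\<tau> (omap L X) \<cdot>\<^bsub>A\<^esub> (\<sigma> (omap L X) \<cdot>\<^bsub>A\<^esub> \<eta> X) = \<eta> X"
      using A.Comp_assoc[OF h sX tX] ts[OF LX] A.Id_Comp[OF h] by simp
    then have "amap L (\<tau> (omap L X)) \<cdot>\<^bsub>B\<^esub> amap L (\<sigma> (omap L X) \<cdot>\<^bsub>A\<^esub> \<eta> X) = amap L (\<eta> X)"
      using functor_Comp[OF L sh tX] by simp
    then show ?thesis
      using tri1[OF X] B.Comp_assoc[OF functor_hom[OF L sh] functor_hom[OF L tX] e] by simp
  qed
  ultimately show ?thesis
    using K L nat_trans_comp[OF \<eta> nat_trans_whisker_right[OF s L]]
      nat_trans_comp[OF nat_trans_whisker_left[OF t L] \<epsilon>]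
    unfolding adjunction_def by blast
qed

section \<open>Fully faithful functors and their replacement by isomorphic ones\<close>

lemma fully_faithfulD:
  assumes "fully_faithful A B J"
  shows ff_functor: "is_functor A B J"
    and faithful: "f \<in> hom A X Y \<Longrightarrow> g \<in> hom A X Y \<Longrightarrow> amap J f = amap J g \<Longrightarrow> f = g"
    and full: "X \<in> Ob A \<Longrightarrow> Y \<in> Ob A \<Longrightarrow> h \<in> hom B (omap J X) (omap J Y) \<Longrightarrow>
      \<exists>f \<in> hom A X Y. amap J f = h"
proof -
  show F: "is_functor A B J" using assms by (simp add: fully_faithful_def)
  have b: "bij_betw (amap J) (hom A X Y) (hom B (omap J X) (omap J Y))"
    if "X \<in> Ob A" "Y \<in> Ob A" for X Y
    using assms that by (simp add: fully_faithful_def)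
  show "f = g" if "f \<in> hom A X Y" "g \<in> hom A X Y" "amap J f = amap J g"
    using that b[of X Y] category.hom_Ob[OF functor_category(1)[OF F] that(1)]
    by (meson bij_betw_imp_inj_on inj_onD)
  show "\<exists>f \<in> hom A X Y. amap J f = h"
    if "X \<in> Ob A" "Y \<in> Ob A" "h \<in> hom B (omap J X) (omap J Y)"
    using b[OF that(1,2)] that(3) unfolding bij_betw_def by (metis imageE)
qed

lemma fully_faithfulI:
  assumes F: "is_functor A B J"
    and "\<And>X Y f g. f \<in> hom A X Y \<Longrightarrow> g \<in> hom A X Y \<Longrightarrow> amap J f = amap J g \<Longrightarrow> f = g"
    and "\<And>X Y h. X \<in> Ob A \<Longrightarrow> Y \<in> Ob A \<Longrightarrow> h \<in> hom B (omap J X) (omap J Y) \<Longrightarrow>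
      \<exists>f \<in> hom A X Y. amap J f = h"
  shows "fully_faithful A B J"
  unfolding fully_faithful_def bij_betw_def
proof (intro conjI ballI set_eqI iffI)
  show "inj_on (amap J) (hom A X Y)" for X Y
    using assms(2) by (meson inj_onI)
qed (use assms(3) functor_hom[OF F] F in fastforce)+

text \<open>On every hom set \<open>K\<close> is \<open>F\<close> followed by conjugation with
  components of \<sigma> and \<tau>, and conjugation by isomorphisms is a bijection of hom
  sets.\<close>

lemma fully_faithful_transport:
  assumes F: "fully_faithful A B F" and i: "is_nat_iso A B F K \<sigma>"
  shows "fully_faithful A B K"
proof -
  obtain \<tau> where s: "is_nat_trans A B F K \<sigma>" and t: "is_nat_trans A B K F \<tau>"
    and ts: "\<And>X. X \<in> Ob A \<Longrightarrow> \<tau> X \<cdot>\<^bsub>B\<^esub> \<sigma> X = Iden B (omap F X)"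
    and st: "\<And>X. X \<in> Ob A \<Longrightarrow> \<sigma> X \<cdot>\<^bsub>B\<^esub> \<tau> X = Iden B (omap K X)"
    by (rule nat_isoE[OF i]) (rule that; blast)
  note FF = nat_functor(1)[OF s] and K = nat_functor(2)[OF s]
  interpret A: category A using K by (rule is_functorD)
  interpret B: category B using K by (rule is_functorD)
  have F_eq: "amap F f = \<tau> Y \<cdot>\<^bsub>B\<^esub> (amap K f \<cdot>\<^bsub>B\<^esub> \<sigma> X)" if f: "f \<in> hom A X Y" for X Y f
    using nat_square[OF s f] ts A.hom_Ob[OF f] functor_hom[OF FF f] nat_hom[OF s] nat_hom[OF t]
      B.Comp_assoc B.Id_Comp by metis
  have K_eq: "amap K f = \<sigma> Y \<cdot>\<^bsub>B\<^esub> (amap F f \<cdot>\<^bsub>B\<^esub> \<tau> X)" if f: "f \<in> hom A X Y" for X Y f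
    using nat_square[OF t f] st A.hom_Ob[OF f] functor_hom[OF K f] nat_hom[OF s] nat_hom[OF t]
      B.Comp_assoc B.Id_Comp by metis
  show ?thesis
  proof (rule fully_faithfulI[OF K])
    show "f = g" if "f \<in> hom A X Y" "g \<in> hom A X Y" "amap K f = amap K g" for X Y f g
      using that F_eq faithful[OF F that(1,2)] by simp
    show "\<exists>f\<in>hom A X Y. amap K f = h"
      if X: "X \<in> Ob A" and Y: "Y \<in> Ob A" and h: "h \<in> hom B (omap K X) (omap K Y)" for X Y h
    proof -
      note c = nat_hom[OF s X] nat_hom[OF s Y] nat_hom[OF t X] nat_hom[OF t Y]
      \<comment> \<open>The conjugate of \<open>h\<close> runs between values of \<open>F\<close>,
        where fullness applies; conjugating back with \<open>K_eq\<close> recovers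
        \<open>h\<close>.\<close>
      obtain f where f: "f \<in> hom A X Y" "amap F f = \<tau> Y \<cdot>\<^bsub>B\<^esub> (h \<cdot>\<^bsub>B\<^esub> \<sigma> X)"
        using full[OF F X Y] B.Comp_hom[OF B.Comp_hom[OF c(1) h] c(4)] by blast
      have "(\<tau> Y \<cdot>\<^bsub>B\<^esub> (h \<cdot>\<^bsub>B\<^esub> \<sigma> X)) \<cdot>\<^bsub>B\<^esub> \<tau> X = \<tau> Y \<cdot>\<^bsub>B\<^esub> h"
        using B.Comp_assoc[OF c(3) c(1) h] B.Comp_Id[OF h] st[OF X]
          B.Comp_assoc[OF c(3) B.Comp_hom[OF c(1) h] c(4)] by simp
      then have "amap K f = h"
        using K_eq[OF f(1)] f(2) B.Comp_assoc[OF h c(4) c(2)] B.Id_Comp[OF h] st[OF Y] by simp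
      then show ?thesis using f(1) by blast
    qed
  qed
qed

text \<open>The isomorphisms \<open>u X\<close> may be chosen independently of one another: the
  action of \<open>K\<close> on arrows is defined by conjugation precisely so that \<open>u\<close>
  becomes natural. This gives full control over the object map of an isomorphic functor.\<close>

lemma conjugate_functor:
  assumes H: "is_functor A B H"
    and u: "\<And>X. X \<in> Ob A \<Longrightarrow> is_iso B (omap H X) (k X) (u X)"
  obtains K where "omap K = k" "is_nat_iso A B H K u"
proof -
  interpret A: category A using H by (rule is_functorD)
  interpret B: category B using H by (rule is_functorD)
  have "\<forall>X\<in>Ob A. \<exists>g. g \<in> hom B (k X) (omap H X) \<and> g \<cdot>\<^bsub>B\<^esub> u X = Iden B (omap H X) \<and>
      u X \<cdot>\<^bsub>B\<^esub> g = Iden B (k X)"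
    using u unfolding is_iso_def by blast
  then obtain v where v: "v X \<in> hom B (k X) (omap H X)"
    "v X \<cdot>\<^bsub>B\<^esub> u X = Iden B (omap H X)" "u X \<cdot>\<^bsub>B\<^esub> v X = Iden B (k X)" if "X \<in> Ob A" for X
    using bchoice by metis
  have uh: "u X \<in> hom B (omap H X) (k X)" if "X \<in> Ob A" for X
    using u[OF that] by (simp add: is_iso_def)
  define K where "K = \<lparr>omap = k, amap = \<lambda>f. u (Cod A f) \<cdot>\<^bsub>B\<^esub> (amap H f \<cdot>\<^bsub>B\<^esub> v (Dom A f))\<rparr>"
  have Kf: "amap K f = u Y \<cdot>\<^bsub>B\<^esub> (amap H f \<cdot>\<^bsub>B\<^esub> v X)" if "f \<in> hom A X Y" for X Y f
    using that by (simp add: K_def hom_def)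
  have Kh: "amap K f \<in> hom B (k X) (k Y)" if f: "f \<in> hom A X Y" for X Y f
    unfolding Kf[OF f] using A.hom_Ob[OF f] B.Comp_hom functor_hom[OF H f] uh v(1) by metis
  \<comment> \<open>This is naturality of the inverse family \<open>v\<close>; it makes consecutive
    conjugates telescope when functoriality of \<open>K\<close> is checked.\<close>
  have vK: "v Y \<cdot>\<^bsub>B\<^esub> amap K f = amap H f \<cdot>\<^bsub>B\<^esub> v X" if f: "f \<in> hom A X Y" for X Y f
    unfolding Kf[OF f] using A.hom_Ob[OF f] B.Comp_cancel_mid[OF uh v(1) v(2) refl]
      B.Comp_hom[OF v(1) functor_hom[OF H f]] by simp
  have K: "is_functor A B K"
  proof (rule is_functorI)
    show "omap K X \<in> Ob B" if "X \<in> Ob A" for X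
      using B.hom_Ob[OF uh[OF that]] by (simp add: K_def)
    show "amap K (Iden A X) = Iden B (omap K X)" if X: "X \<in> Ob A" for X
      using Kf[OF A.Id_hom[OF X]] functor_Id[OF H X] B.Id_Comp[OF v(1)[OF X]] v(3)[OF X]
      by (simp add: K_def)
    show "amap K (g \<cdot>\<^bsub>A\<^esub> f) = amap K g \<cdot>\<^bsub>B\<^esub> amap K f"
      if f: "f \<in> hom A X Y" and g: "g \<in> hom A Y Z" for X Y Z f g
    proof -
      note o = A.hom_Ob[OF f] A.hom_Ob(2)[OF g]
      note c = functor_hom[OF H f] functor_hom[OF H g] v(1)[OF o(1)] v(1)[OF o(2)] uh[OF o(3)]
      have "amap K (g \<cdot>\<^bsub>A\<^esub> f) = u Z \<cdot>\<^bsub>B\<^esub> (amap H g \<cdot>\<^bsub>B\<^esub> (amap H f \<cdot>\<^bsub>B\<^esub> v X))"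
        using Kf[OF A.Comp_hom[OF f g]] functor_Comp[OF H f g] B.Comp_assoc[OF c(3,1,2)] by simp
      also have "\<dots> = u Z \<cdot>\<^bsub>B\<^esub> (amap H g \<cdot>\<^bsub>B\<^esub> (v Y \<cdot>\<^bsub>B\<^esub> amap K f))"
        using vK[OF f] by simp
      also have "\<dots> = amap K g \<cdot>\<^bsub>B\<^esub> amap K f"
        unfolding Kf[OF g] using c Kh[OF f] by (simp add: hom_def B.Ar_simps)
      finally show ?thesis .
    qed
  qed (use Kh A.category_axioms B.category_axioms in \<open>simp_all add: K_def\<close>)
  have "is_nat_trans A B H K u"
  proof (rule is_nat_transI[OF H K])
    show "u Y \<cdot>\<^bsub>B\<^esub> amap H f = amap K f \<cdot>\<^bsub>B\<^esub> u X" if f: "f \<in> hom A X Y" for X Y f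
    proof -
      note o = A.hom_Ob[OF f]
      note c = functor_hom[OF H f] v(1)[OF o(1)] uh[OF o(1)] uh[OF o(2)]
      show ?thesis
        unfolding Kf[OF f] using c v(2)[OF o(1)] by (simp add: hom_def B.Ar_simps)
    qed
  qed (simp add: K_def uh)
  then have "is_nat_iso A B H K u"
    using u by (simp add: is_nat_iso_def K_def)
  then show ?thesis using that[of K] by (simp add: K_def)
qed


section \<open>Restriction along fully faithful functors\<close>

text \<open>The square commutes on the nose rather than up to isomorphism, so equations between
  components can be moved across it by rewriting. It is demanded only on objects and arrows of
  \<open>A\<close>, where functor values are meaningful.\<close>

definition intertwines ::
  "('o1, 'm1) cat \<Rightarrow> ('o1, 'm1, 'o3, 'm3) fnctr \<Rightarrow> ('o2, 'm2, 'o4, 'm4) fnctr \<Rightarrow>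
    ('o3, 'm3, 'o4, 'm4) fnctr \<Rightarrow> ('o1, 'm1, 'o2, 'm2) fnctr \<Rightarrow> bool" where
  "intertwines A I J H' H \<longleftrightarrow>
     (\<forall>X \<in> Ob A. omap H' (omap I X) = omap J (omap H X)) \<and>
     (\<forall>f \<in> Ar A. amap H' (amap I f) = amap J (amap H f))"

lemma intertwinesD:
  assumes "intertwines A I J H' H"
  shows "X \<in> Ob A \<Longrightarrow> omap H' (omap I X) = omap J (omap H X)"
    "f \<in> hom A X Y \<Longrightarrow> amap H' (amap I f) = amap J (amap H f)"
  using assms by (auto simp: intertwines_def hom_def)

lemma intertwines_id: "intertwines A I I id_fun id_fun"
  by (simp add: intertwines_def id_fun_def)

lemma intertwines_comp:
  assumes "is_functor A B F" "intertwines A I J F' F" "intertwines B J K G' G"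
  shows "intertwines A I K (G' \<circ>\<^sub>F F') (G \<circ>\<^sub>F F)"
proof -
  interpret A: category A using assms(1) by (rule is_functorD)
  have "amap F f \<in> Ar B" if "f \<in> Ar A" for f
    using functor_hom[OF assms(1) A.Ar_hom[OF that]] by (simp add: hom_def)
  then show ?thesis
    using assms functor_Ob[OF assms(1)] by (simp add: intertwines_def comp_fun_def)
qed

lemma ff_reflects_iso:
  assumes J: "fully_faithful A B J" and f: "f \<in> hom A X Y"
    and iso: "is_iso B (omap J X) (omap J Y) (amap J f)"
  shows "is_iso A X Y f"
proof -
  interpret A: category A using ff_functor[OF J] by (rule is_functorD)
  note o = A.hom_Ob[OF f]
  obtain h where h: "h \<in> hom B (omap J Y) (omap J X)"
    "h \<cdot>\<^bsub>B\<^esub> amap J f = Iden B (omap J X)" "amap J f \<cdot>\<^bsub>B\<^esub> h = Iden B (omap J Y)"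
    using iso unfolding is_iso_def by blast
  obtain g where g: "g \<in> hom A Y X" "amap J g = h"
    using full[OF J o(2,1) h(1)] by blast
  have "g \<cdot>\<^bsub>A\<^esub> f = Iden A X"
    using faithful[OF J A.Comp_hom[OF f g(1)] A.Id_hom[OF o(1)]] functor_Comp[OF ff_functor[OF J] f g(1)]
      functor_Id[OF ff_functor[OF J] o(1)] g(2) h(2) by simp
  moreover have "f \<cdot>\<^bsub>A\<^esub> g = Iden A Y"
    using faithful[OF J A.Comp_hom[OF g(1) f] A.Id_hom[OF o(2)]] functor_Comp[OF ff_functor[OF J] g(1) f]
      functor_Id[OF ff_functor[OF J] o(2)] g(2) h(3) by simp
  ultimately show ?thesis
    using f g(1) unfolding is_iso_def by blast
qed

text \<open>Intertwining places both ends of the component at \<open>omap I X\<close> in the image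
  of \<open>J\<close>, so fullness supplies a preimage, and faithfulness pulls the naturality
  squares back. The equation for \<open>amap J (\<tau> X)\<close> is exported so that further
  identities can be pulled back in the same way.\<close>

lemma restrict_nat_trans:
  assumes I: "is_functor A A' I" and J: "fully_faithful B B' J"
    and H: "is_functor A B H" and K: "is_functor A B K"
    and h: "intertwines A I J H' H" and k: "intertwines A I J K' K"
    and t: "is_nat_trans A' B' H' K' \<tau>'"
  obtains \<tau> where "is_nat_trans A B H K \<tau>"
    "\<And>X. X \<in> Ob A \<Longrightarrow> amap J (\<tau> X) = \<tau>' (omap I X)"
proof -
  interpret A: category A using I by (rule is_functorD)
  interpret B: category B using H by (rule is_functorD)
  note JF = ff_functor[OF J]
  have "\<forall>X\<in>Ob A. \<exists>f. f \<in> hom B (omap H X) (omap K X) \<and> amap J f = \<tau>' (omap I X)"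
  proof
    fix X assume X: "X \<in> Ob A"
    show "\<exists>f. f \<in> hom B (omap H X) (omap K X) \<and> amap J f = \<tau>' (omap I X)"
      using full[OF J functor_Ob[OF H X] functor_Ob[OF K X]] nat_hom[OF t functor_Ob[OF I X]]
        intertwinesD(1)[OF h X] intertwinesD(1)[OF k X] by auto
  qed
  then obtain \<tau> where \<tau>: "\<tau> X \<in> hom B (omap H X) (omap K X)"
    "amap J (\<tau> X) = \<tau>' (omap I X)" if "X \<in> Ob A" for X
    using bchoice by metis
  have "is_nat_trans A B H K \<tau>"
  proof (rule is_nat_transI[OF H K])
    show "\<tau> Y \<cdot>\<^bsub>B\<^esub> amap H f = amap K f \<cdot>\<^bsub>B\<^esub> \<tau> X" if f: "f \<in> hom A X Y" for X Y f
    proof -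
      note o = A.hom_Ob[OF f] and Hf = functor_hom[OF H f] and Kf = functor_hom[OF K f]
      show ?thesis
        using faithful[OF J B.Comp_hom[OF Hf \<tau>(1)[OF o(2)]] B.Comp_hom[OF \<tau>(1)[OF o(1)] Kf]]
          functor_Comp[OF JF Hf \<tau>(1)[OF o(2)]] functor_Comp[OF JF \<tau>(1)[OF o(1)] Kf]
          nat_square[OF t functor_hom[OF I f]] \<tau>(2)[OF o(1)] \<tau>(2)[OF o(2)]
          intertwinesD(2)[OF h f] intertwinesD(2)[OF k f] by simp
    qed
  qed (use \<tau> in auto)
  then show ?thesis using that \<tau>(2) by blast
qed

lemma restrict_nat_iso:
  assumes I: "is_functor A A' I" and J: "fully_faithful B B' J"
    and H: "is_functor A B H" and K: "is_functor A B K"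
    and h: "intertwines A I J H' H" and k: "intertwines A I J K' K"
    and t: "is_nat_iso A' B' H' K' \<tau>'"
  obtains \<tau> where "is_nat_iso A B H K \<tau>"
proof -
  obtain \<tau> where \<tau>: "is_nat_trans A B H K \<tau>"
    "\<And>X. X \<in> Ob A \<Longrightarrow> amap J (\<tau> X) = \<tau>' (omap I X)"
    by (rule restrict_nat_trans[OF I J H K h k is_nat_isoD(1)[OF t]]) (rule that; blast)
  have "is_iso B (omap H X) (omap K X) (\<tau> X)" if X: "X \<in> Ob A" for X
    using ff_reflects_iso[OF J nat_hom[OF \<tau>(1) X]] is_nat_isoD(2)[OF t functor_Ob[OF I X]]
      \<tau>(2)[OF X] intertwinesD(1)[OF h X] intertwinesD(1)[OF k X] by simp
  then show ?thesis using \<tau>(1) that unfolding is_nat_iso_def by blast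
qed

text \<open>After applying \<open>J\<close> or \<open>I\<close>, the triangle identities become
  those of the given adjunction at objects in the image of the embeddings, and faithfulness reflects
  them. The values of the restricted unit and counit are kept for the bireflection equation.\<close>

lemma restrict_adjunction:
  assumes I: "fully_faithful A A' I" and J: "fully_faithful B B' J"
    and L: "is_functor A B L" and R: "is_functor B A R"
    and l: "intertwines A I J L' L" and r: "intertwines B J I R' R"
    and adj: "adjunction A' B' L' R' \<eta>' \<epsilon>'"
  obtains \<eta> \<epsilon> where "adjunction A B L R \<eta> \<epsilon>"
    "\<And>X. X \<in> Ob A \<Longrightarrow> amap I (\<eta> X) = \<eta>' (omap I X)"
    "\<And>Y. Y \<in> Ob B \<Longrightarrow> amap J (\<epsilon> Y) = \<epsilon>' (omap J Y)"
proof -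
  interpret A: category A using L by (rule is_functorD)
  interpret B: category B using L by (rule is_functorD)
  note IF = ff_functor[OF I] and JF = ff_functor[OF J]
  note adjD = adjunctionD[OF adj]
  obtain \<eta> where \<eta>: "is_nat_trans A A id_fun (R \<circ>\<^sub>F L) \<eta>"
    "\<And>X. X \<in> Ob A \<Longrightarrow> amap I (\<eta> X) = \<eta>' (omap I X)"
    by (rule restrict_nat_trans[OF IF I is_functor_id[OF A.category_axioms] is_functor_comp[OF L R]
      intertwines_id intertwines_comp[OF L l r] adjD(3)]) (rule that; blast)
  obtain \<epsilon> where \<epsilon>: "is_nat_trans B B (L \<circ>\<^sub>F R) id_fun \<epsilon>"
    "\<And>Y. Y \<in> Ob B \<Longrightarrow> amap J (\<epsilon> Y) = \<epsilon>' (omap J Y)"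
    by (rule restrict_nat_trans[OF JF J is_functor_comp[OF R L] is_functor_id[OF B.category_axioms]
      intertwines_comp[OF R r l] intertwines_id adjD(4)]) (rule that; blast)
  have "\<epsilon> (omap L X) \<cdot>\<^bsub>B\<^esub> amap L (\<eta> X) = Iden B (omap L X)" if X: "X \<in> Ob A" for X
  proof -
    note LX = functor_Ob[OF L X]
    note h = nat_hom[OF \<eta>(1) X, unfolded fun_simps] and e = nat_hom[OF \<epsilon>(1) LX, unfolded fun_simps]
    note Lh = functor_hom[OF L h]
    have "amap J (\<epsilon> (omap L X) \<cdot>\<^bsub>B\<^esub> amap L (\<eta> X)) = amap J (Iden B (omap L X))"
      using functor_Comp[OF JF Lh e] functor_Id[OF JF LX] \<epsilon>(2)[OF LX] \<eta>(2)[OF X]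
        intertwinesD(2)[OF l h] intertwinesD(1)[OF l X] adjD(5)[OF functor_Ob[OF IF X]] by simp
    then show ?thesis
      using faithful[OF J B.Comp_hom[OF Lh e] B.Id_hom[OF LX]] by simp
  qed
  moreover have "amap R (\<epsilon> Y) \<cdot>\<^bsub>A\<^esub> \<eta> (omap R Y) = Iden A (omap R Y)" if Y: "Y \<in> Ob B" for Y
  proof -
    note RY = functor_Ob[OF R Y]
    note e = nat_hom[OF \<epsilon>(1) Y, unfolded fun_simps] and h = nat_hom[OF \<eta>(1) RY, unfolded fun_simps]
    note Re = functor_hom[OF R e]
    have "amap I (amap R (\<epsilon> Y) \<cdot>\<^bsub>A\<^esub> \<eta> (omap R Y)) = amap I (Iden A (omap R Y))"
      using functor_Comp[OF IF h Re] functor_Id[OF IF RY] \<eta>(2)[OF RY] \<epsilon>(2)[OF Y]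
        intertwinesD(2)[OF r e] intertwinesD(1)[OF r Y] adjD(6)[OF functor_Ob[OF JF Y]] by simp
    then show ?thesis
      using faithful[OF I A.Comp_hom[OF h Re] A.Id_hom[OF RY]] by simp
  qed
  ultimately have "adjunction A B L R \<eta> \<epsilon>"
    using L R \<eta>(1) \<epsilon>(1) unfolding adjunction_def by blast
  then show ?thesis using that \<eta>(2) \<epsilon>(2) by blast
qed

text \<open>On hom sets, \<open>H\<close> followed by \<open>J\<close> equals \<open>I\<close>
  followed by \<open>H'\<close>. Three of these four maps are bijections, hence so is the
  fourth.\<close>

lemma restrict_fully_faithful:
  assumes I: "fully_faithful A A' I" and J: "fully_faithful B B' J"
    and H: "is_functor A B H" and h: "intertwines A I J H' H" and H': "fully_faithful A' B' H'"
  shows "fully_faithful A B H"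
proof (rule fully_faithfulI[OF H])
  note IF = ff_functor[OF I] and JF = ff_functor[OF J]
  show "f = g" if f: "f \<in> hom A X Y" and g: "g \<in> hom A X Y" and eq: "amap H f = amap H g" for X Y f g
  proof -
    have "amap H' (amap I f) = amap H' (amap I g)"
      using eq intertwinesD(2)[OF h f] intertwinesD(2)[OF h g] by simp
    then have "amap I f = amap I g"
      using faithful[OF H' functor_hom[OF IF f] functor_hom[OF IF g]] by simp
    then show ?thesis using faithful[OF I f g] by simp
  qed
  show "\<exists>f\<in>hom A X Y. amap H f = k"
    if X: "X \<in> Ob A" and Y: "Y \<in> Ob A" and k: "k \<in> hom B (omap H X) (omap H Y)" for X Y k
  proof -
    obtain f' where f': "f' \<in> hom A' (omap I X) (omap I Y)" "amap H' f' = amap J k"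
      using full[OF H' functor_Ob[OF IF X] functor_Ob[OF IF Y], of "amap J k"]
        functor_hom[OF JF k] intertwinesD(1)[OF h X] intertwinesD(1)[OF h Y] by auto
    obtain f where f: "f \<in> hom A X Y" "amap I f = f'"
      using full[OF I X Y f'(1)] by blast
    then show ?thesis
      using faithful[OF J functor_hom[OF H f(1)] k] intertwinesD(2)[OF h f(1)] f'(2) by auto
  qed
qed

text \<open>\<open>J\<close> need not be injective on objects, so the object map \<open>k\<close> of
  the factorisation is prescribed. Arrows lift by fullness, and faithfulness forces the lifts to
  respect identities and composition.\<close>

lemma factor_through_fully_faithful:
  assumes J: "fully_faithful B B' J" and K: "is_functor A B' K"
    and k: "\<And>X. X \<in> Ob A \<Longrightarrow> k X \<in> Ob B \<and> omap K X = omap J (k X)"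
  obtains F where "is_functor A B F" "\<And>X. X \<in> Ob A \<Longrightarrow> omap K X = omap J (omap F X)"
    "\<And>f. f \<in> Ar A \<Longrightarrow> amap K f = amap J (amap F f)"
proof -
  interpret A: category A using K by (rule is_functorD)
  note JF = ff_functor[OF J]
  interpret B: category B using JF by (rule is_functorD)
  have "\<forall>f\<in>Ar A. \<exists>g. g \<in> hom B (k (Dom A f)) (k (Cod A f)) \<and> amap J g = amap K f"
  proof
    fix f assume f: "f \<in> Ar A"
    note o = A.Dom_Ob[OF f] A.Cod_Ob[OF f]
    show "\<exists>g. g \<in> hom B (k (Dom A f)) (k (Cod A f)) \<and> amap J g = amap K f"
      using full[OF J, of "k (Dom A f)" "k (Cod A f)" "amap K f"] k[OF o(1)] k[OF o(2)]
        functor_hom[OF K A.Ar_hom[OF f]] by auto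
  qed
  then obtain a where a: "a f \<in> hom B (k (Dom A f)) (k (Cod A f))" "amap J (a f) = amap K f"
    if "f \<in> Ar A" for f
    using bchoice by metis
  have ah: "a f \<in> hom B (k X) (k Y)" "amap J (a f) = amap K f" if "f \<in> hom A X Y" for X Y f
    using a[of f] that by (auto simp: hom_def)
  have F: "is_functor A B \<lparr>omap = k, amap = a\<rparr>"
  proof (rule is_functorI, unfold fnctr.simps)
    show "a (Iden A X) = Iden B (k X)" if X: "X \<in> Ob A" for X
      using faithful[OF J ah(1)[OF A.Id_hom[OF X]] B.Id_hom] ah(2)[OF A.Id_hom[OF X]] k[OF X]
        functor_Id[OF K X] functor_Id[OF JF] by simp
    show "a (g \<cdot>\<^bsub>A\<^esub> f) = a g \<cdot>\<^bsub>B\<^esub> a f" if f: "f \<in> hom A X Y" and g: "g \<in> hom A Y Z" for X Y Z f g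
      using faithful[OF J ah(1)[OF A.Comp_hom[OF f g]] B.Comp_hom[OF ah(1)[OF f] ah(1)[OF g]]]
        ah(2)[OF A.Comp_hom[OF f g]] functor_Comp[OF K f g] functor_Comp[OF JF ah(1)[OF f] ah(1)[OF g]]
        ah(2)[OF f] ah(2)[OF g] by simp
  qed (use ah k A.category_axioms B.category_axioms in blast)+
  show ?thesis
    by (rule that[OF F]) (use k a in auto)
qed

text \<open>This isolates what restriction uses of the two completions. Density is asked of
  \<open>I\<close> because the values of a functor \<open>F'\<close> from \<open>C'\<close> to
  \<open>D'\<close> must be moved into the image of \<open>I\<close>.\<close>

locale dense_square =
  fixes D :: "('o1, 'm1) cat" and C :: "('o2, 'm2) cat"
    and D' :: "('o3, 'm3) cat" and C' :: "('o4, 'm4) cat"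
    and I :: "('o1, 'm1, 'o3, 'm3) fnctr" and J :: "('o2, 'm2, 'o4, 'm4) fnctr"
    and G' :: "('o3, 'm3, 'o4, 'm4) fnctr" and G :: "('o1, 'm1, 'o2, 'm2) fnctr"
  assumes I: "fully_faithful D D' I" and J: "fully_faithful C C' J"
    and dense: "X' \<in> Ob D' \<Longrightarrow> \<exists>X \<in> Ob D. \<exists>u. is_iso D' X' (omap I X) u"
    and G: "is_functor D C G" and G': "is_functor D' C' G'"
    and GG': "intertwines D I J G' G"
begin

text \<open>Up to isomorphism, every functor back is strictly compatible with \<open>I\<close> and \<open>J\<close>, so that the
  restriction lemmas apply.\<close>

lemma strictify:
  assumes F': "is_functor C' D' F'"
  obtains F'' F \<sigma> where "is_nat_iso C' D' F' F'' \<sigma>" "is_functor C D F" "intertwines C J I F'' F"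
proof -
  obtain k u where ku: "k X' \<in> Ob D" "is_iso D' X' (omap I (k X')) (u X')" if "X' \<in> Ob D'" for X'
    using dense by metis
  \<comment> \<open>Values are replaced over all of \<open>C'\<close>, not only over the image of
    \<open>J\<close>, so that \<open>F''\<close> is isomorphic to \<open>F'\<close> as a functor on
    \<open>C'\<close> and adjunctions can be transported before they are restricted.\<close>
  obtain F'' where F'': "omap F'' = (\<lambda>X. omap I (k (omap F' X)))"
    "is_nat_iso C' D' F' F'' (\<lambda>X. u (omap F' X))"
    using conjugate_functor[OF F', of "\<lambda>X. omap I (k (omap F' X))" "\<lambda>X. u (omap F' X)"]
      ku(2) functor_Ob[OF F'] by blast
  note JF = ff_functor[OF J]
  have K: "is_functor C D' (F'' \<circ>\<^sub>F J)"
    using is_functor_comp[OF JF] is_nat_isoD(1)[OF F''(2)] nat_functor(2) by blast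
  have k: "k (omap F' (omap J X)) \<in> Ob D \<and>
      omap (F'' \<circ>\<^sub>F J) X = omap I (k (omap F' (omap J X)))" if "X \<in> Ob C" for X
    using ku(1) functor_Ob[OF F' functor_Ob[OF JF that]] F''(1) by (simp add: fun_simps)
  \<comment> \<open>Restricted along \<open>J\<close>, the functor \<open>F''\<close> takes object
    values literally of the form \<open>omap I Y\<close>, so it factors through
    \<open>I\<close>.\<close>
  obtain F where "is_functor C D F" "\<And>X. X \<in> Ob C \<Longrightarrow> omap (F'' \<circ>\<^sub>F J) X = omap I (omap F X)"
    "\<And>f. f \<in> Ar C \<Longrightarrow> amap (F'' \<circ>\<^sub>F J) f = amap I (amap F f)"
    using factor_through_fully_faithful[OF I K, of "\<lambda>X. k (omap F' (omap J X))"] k by blast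
  then show ?thesis
    using that[OF F''(2)] by (simp add: intertwines_def fun_simps)
qed

text \<open>The isomorphism from \<open>strictify\<close> carries both the adjunction and full
  faithfulness from \<open>F'\<close> to \<open>F''\<close>; these then restrict to \<open>F\<close>
  because both squares commute strictly.\<close>

lemma coreflection_restrict:
  assumes "coreflection D' C' G'"
  shows "coreflection D C G"
proof -
  obtain F' \<eta> \<epsilon> where adj: "adjunction C' D' F' G' \<eta> \<epsilon>" and ff: "fully_faithful C' D' F'"
    using assms unfolding coreflection_def by blast
  obtain F'' F \<sigma> where s: "is_nat_iso C' D' F' F'' \<sigma>" and F: "is_functor C D F"
    and FF: "intertwines C J I F'' F"
    using strictify[OF ff_functor[OF ff]] by blast
  obtain \<tau> where t: "is_nat_trans C' D' F' F'' \<sigma>" "is_nat_trans C' D' F'' F' \<tau>"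
    "\<And>X. X \<in> Ob C' \<Longrightarrow> \<tau> X \<cdot>\<^bsub>D'\<^esub> \<sigma> X = Iden D' (omap F' X)"
    "\<And>X. X \<in> Ob C' \<Longrightarrow> \<sigma> X \<cdot>\<^bsub>D'\<^esub> \<tau> X = Iden D' (omap F'' X)"
    by (rule nat_isoE[OF s]) (rule that; blast)
  obtain \<eta>\<^sub>0 \<epsilon>\<^sub>0 where "adjunction C D F G \<eta>\<^sub>0 \<epsilon>\<^sub>0"
    by (rule restrict_adjunction[OF J I F G FF GG' adjunction_transport_left[OF adj t]])
  moreover have "fully_faithful C D F"
    using restrict_fully_faithful[OF J I F FF fully_faithful_transport[OF ff s]] .
  ultimately show ?thesis
    using G unfolding coreflection_def by blast
qed

lemma reflection_restrict:
  assumes "reflection D' C' G'"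
  shows "reflection D C G"
proof -
  obtain F' \<eta> \<epsilon> where adj: "adjunction D' C' G' F' \<eta> \<epsilon>" and ff: "fully_faithful C' D' F'"
    using assms unfolding reflection_def by blast
  obtain F'' F \<sigma> where s: "is_nat_iso C' D' F' F'' \<sigma>" and F: "is_functor C D F"
    and FF: "intertwines C J I F'' F"
    using strictify[OF ff_functor[OF ff]] by blast
  obtain \<tau> where t: "is_nat_trans C' D' F' F'' \<sigma>" "is_nat_trans C' D' F'' F' \<tau>"
    "\<And>X. X \<in> Ob C' \<Longrightarrow> \<tau> X \<cdot>\<^bsub>D'\<^esub> \<sigma> X = Iden D' (omap F' X)"
    "\<And>X. X \<in> Ob C' \<Longrightarrow> \<sigma> X \<cdot>\<^bsub>D'\<^esub> \<tau> X = Iden D' (omap F'' X)"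
    by (rule nat_isoE[OF s]) (rule that; blast)
  obtain \<eta>\<^sub>0 \<epsilon>\<^sub>0 where "adjunction D C G F \<eta>\<^sub>0 \<epsilon>\<^sub>0"
    by (rule restrict_adjunction[OF I J G F GG' FF adjunction_transport_right[OF adj t]])
  moreover have "fully_faithful C D F"
    using restrict_fully_faithful[OF J I F FF fully_faithful_transport[OF ff s]] .
  ultimately show ?thesis
    using G unfolding reflection_def by blast
qed

text \<open>One strictified functor serves both adjunctions. Its left counit acquires \<tau> on the
  right and its right unit acquires \<sigma> on the left, so their composite is \<sigma> after
  (\<open>\<eta>\<^sub>r\<close> after \<open>\<epsilon>\<^sub>l\<close>) after \<tau>. The bracket
  is an identity by assumption, and \<sigma> after \<tau> is one as well.\<close>

lemma bireflection_restrict: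
  assumes "bireflection D' C' G'"
  shows "bireflection D C G"
proof -
  obtain F' \<eta>\<^sub>l \<epsilon>\<^sub>l \<eta>\<^sub>r \<epsilon>\<^sub>r where ff: "fully_faithful C' D' F'"
    and l: "adjunction C' D' F' G' \<eta>\<^sub>l \<epsilon>\<^sub>l" and r: "adjunction D' C' G' F' \<eta>\<^sub>r \<epsilon>\<^sub>r"
    and re: "\<And>X. X \<in> Ob D' \<Longrightarrow> \<eta>\<^sub>r X \<cdot>\<^bsub>D'\<^esub> \<epsilon>\<^sub>l X = Iden D' (omap (F' \<circ>\<^sub>F G') X)"
    using assms unfolding bireflection_def by blast
  obtain F'' F \<sigma> where s: "is_nat_iso C' D' F' F'' \<sigma>" and F: "is_functor C D F"
    and FF: "intertwines C J I F'' F"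
    using strictify[OF ff_functor[OF ff]] by blast
  obtain \<tau> where t: "is_nat_trans C' D' F' F'' \<sigma>" "is_nat_trans C' D' F'' F' \<tau>"
    "\<And>X. X \<in> Ob C' \<Longrightarrow> \<tau> X \<cdot>\<^bsub>D'\<^esub> \<sigma> X = Iden D' (omap F' X)"
    "\<And>X. X \<in> Ob C' \<Longrightarrow> \<sigma> X \<cdot>\<^bsub>D'\<^esub> \<tau> X = Iden D' (omap F'' X)"
    by (rule nat_isoE[OF s]) (rule that; blast)
  have l'': "adjunction C' D' F'' G' (\<lambda>X. amap G' (\<sigma> X) \<cdot>\<^bsub>C'\<^esub> \<eta>\<^sub>l X)
      (\<lambda>Y. \<epsilon>\<^sub>l Y \<cdot>\<^bsub>D'\<^esub> \<tau> (omap G' Y))"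
    by (rule adjunction_transport_left[OF l t])
  have r'': "adjunction D' C' G' F'' (\<lambda>X. \<sigma> (omap G' X) \<cdot>\<^bsub>D'\<^esub> \<eta>\<^sub>r X)
      (\<lambda>Y. \<epsilon>\<^sub>r Y \<cdot>\<^bsub>C'\<^esub> amap G' (\<tau> Y))"
    by (rule adjunction_transport_right[OF r t])
  obtain h\<^sub>l e\<^sub>l where l0: "adjunction C D F G h\<^sub>l e\<^sub>l"
    "\<And>Y. Y \<in> Ob D \<Longrightarrow> amap I (e\<^sub>l Y) = \<epsilon>\<^sub>l (omap I Y) \<cdot>\<^bsub>D'\<^esub> \<tau> (omap G' (omap I Y))"
    by (rule restrict_adjunction[OF J I F G FF GG' l'']) (rule that; blast)
  obtain h\<^sub>r e\<^sub>r where r0: "adjunction D C G F h\<^sub>r e\<^sub>r"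
    "\<And>Y. Y \<in> Ob D \<Longrightarrow> amap I (h\<^sub>r Y) = \<sigma> (omap G' (omap I Y)) \<cdot>\<^bsub>D'\<^esub> \<eta>\<^sub>r (omap I Y)"
    by (rule restrict_adjunction[OF I J G F GG' FF r'']) (rule that; blast)
  note IF = ff_functor[OF I]
  interpret D: category D using IF by (rule is_functorD)
  interpret D': category D' using IF by (rule is_functorD)
  have "h\<^sub>r X \<cdot>\<^bsub>D\<^esub> e\<^sub>l X = Iden D (omap (F \<circ>\<^sub>F G) X)" if X: "X \<in> Ob D" for X
  proof -
    let ?X = "omap I X"
    note IX = functor_Ob[OF IF X] and GX = functor_Ob[OF G X]
    note GIX = functor_Ob[OF G' IX]
    note c = nat_hom[OF t(2) GIX] nat_hom[OF adjunctionD(4)[OF l] IX, unfolded fun_simps]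
      nat_hom[OF adjunctionD(3)[OF r] IX, unfolded fun_simps] nat_hom[OF t(1) GIX]
    note eh = nat_hom[OF adjunctionD(4)[OF l0(1)] X, unfolded fun_simps]
      nat_hom[OF adjunctionD(3)[OF r0(1)] X, unfolded fun_simps]
    have "\<eta>\<^sub>r ?X \<cdot>\<^bsub>D'\<^esub> (\<epsilon>\<^sub>l ?X \<cdot>\<^bsub>D'\<^esub> \<tau> (omap G' ?X)) = \<tau> (omap G' ?X)"
      using D'.Comp_cancel_mid[OF c(2,3) re[OF IX, unfolded fun_simps] refl c(1)] .
    then have "amap I (h\<^sub>r X \<cdot>\<^bsub>D\<^esub> e\<^sub>l X) = \<sigma> (omap G' ?X) \<cdot>\<^bsub>D'\<^esub> \<tau> (omap G' ?X)"
      using functor_Comp[OF IF eh] l0(2)[OF X] r0(2)[OF X]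
        D'.Comp_assoc[OF D'.Comp_hom[OF c(1,2)] c(3,4)] by simp
    also have "\<dots> = amap I (Iden D (omap F (omap G X)))"
      using t(4)[OF GIX] intertwinesD(1)[OF GG' X] intertwinesD(1)[OF FF GX]
        functor_Id[OF IF functor_Ob[OF F GX]] by simp
    finally show ?thesis
      using faithful[OF I D.Comp_hom[OF eh] D.Id_hom[OF functor_Ob[OF F GX]]]
      by (simp add: fun_simps)
  qed
  moreover have "fully_faithful C D F"
    using restrict_fully_faithful[OF J I F FF fully_faithful_transport[OF ff s]] .
  ultimately show ?thesis
    using G l0(1) r0(1) unfolding bireflection_def by blast
qed

lemma equivalence_restrict:
  assumes "equivalence D' C' G'"
  shows "equivalence D C G"
proof -
  obtain F' \<alpha> \<beta> where F': "is_functor C' D' F'"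
    and \<alpha>: "is_nat_iso D' D' id_fun (F' \<circ>\<^sub>F G') \<alpha>" and \<beta>: "is_nat_iso C' C' (G' \<circ>\<^sub>F F') id_fun \<beta>"
    using assms unfolding equivalence_def by blast
  obtain F'' F \<sigma> where s: "is_nat_iso C' D' F' F'' \<sigma>" and F: "is_functor C D F"
    and FF: "intertwines C J I F'' F"
    using strictify[OF F'] by blast
  obtain \<tau> where t: "is_nat_iso C' D' F'' F' \<tau>"
    by (rule nat_iso_inverse[OF s])
  \<comment> \<open>Whiskering the strictification isomorphisms with \<open>G'\<close> and pasting
    them onto \<alpha> and \<beta> replaces \<open>F'\<close> by \<open>F''\<close> in both
    composites.\<close>
  note \<alpha>'' = nat_iso_comp[OF \<alpha> nat_iso_whisker_right[OF s G']]
    and \<beta>'' = nat_iso_comp[OF nat_iso_whisker_left[OF t G'] \<beta>]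
  note IF = ff_functor[OF I] and JF = ff_functor[OF J]
  obtain a where "is_nat_iso D D id_fun (F \<circ>\<^sub>F G) a"
    by (rule restrict_nat_iso[OF IF I is_functor_id[OF functor_category(1)[OF G]]
      is_functor_comp[OF G F] intertwines_id intertwines_comp[OF G GG' FF] \<alpha>''])
  moreover obtain b where "is_nat_iso C C (G \<circ>\<^sub>F F) id_fun b"
    by (rule restrict_nat_iso[OF JF J is_functor_comp[OF F G]
      is_functor_id[OF functor_category(2)[OF G]] intertwines_comp[OF F FF GG'] intertwines_id \<beta>''])
  ultimately show ?thesis
    using G F unfolding equivalence_def by blast
qed

end


section \<open>Idempotent completion\<close>

lemma completion_simps:
  "Iden (completion C) (X, e) = ((X, e), e, (X, e))"
  "(b', g, c) \<cdot>\<^bsub>completion C\<^esub> (a, f, b) = (a, g \<cdot>\<^bsub>C\<^esub> f, c)"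
  "(X, e) \<in> Ob (completion C) \<longleftrightarrow> is_idempotent C X e"
  by (simp_all add: completion_def)

lemma completion_fun_simps:
  "omap (completion_fun F) (X, e) = (omap F X, amap F e)"
  "amap (completion_fun F) ((X, e), f, (X', e')) =
     ((omap F X, amap F e), amap F f, (omap F X', amap F e'))"
  by (simp_all add: completion_fun_def)

lemma completion_fun_id: "completion_fun id_fun = id_fun"
  by (simp add: completion_fun_def id_fun_def fun_eq_iff)

lemma completion_fun_comp: "completion_fun (G \<circ>\<^sub>F F) = completion_fun G \<circ>\<^sub>F completion_fun F"
  by (simp add: completion_fun_def comp_fun_def fun_eq_iff)

lemma is_idempotentD:
  assumes "is_idempotent C X e"
  shows "X \<in> Ob C" "e \<in> hom C X X" "e \<cdot>\<^bsub>C\<^esub> e = e"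
  using assms by (auto simp: is_idempotent_def)

text \<open>Multiplying \<open>f = e' f e\<close> by \<open>e'\<close> on the left or by
  \<open>e\<close> on the right splits it into two absorption laws, which are directly usable as
  rewrite rules.\<close>

lemma hom_completion_iff:
  assumes "category C"
  shows "a \<in> hom (completion C) (X, e) (X', e') \<longleftrightarrow>
    (\<exists>f. a = ((X, e), f, (X', e')) \<and> is_idempotent C X e \<and> is_idempotent C X' e' \<and>
      f \<in> hom C X X' \<and> e' \<cdot>\<^bsub>C\<^esub> f = f \<and> f \<cdot>\<^bsub>C\<^esub> e = f)"
proof -
  interpret category C by fact
  have "e' \<cdot>\<^bsub>C\<^esub> f = f \<and> f \<cdot>\<^bsub>C\<^esub> e = f"
    if "is_idempotent C X e" "is_idempotent C X' e'" "f \<in> hom C X X'" "f = e' \<cdot>\<^bsub>C\<^esub> f \<cdot>\<^bsub>C\<^esub> e" for f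
    using that unfolding is_idempotent_def by (metis Comp_assoc Comp_hom)
  then show ?thesis
    unfolding hom_completion by auto
qed

lemma functor_idempotent:
  assumes F: "is_functor A B F" and e: "is_idempotent A X e"
  shows "is_idempotent B (omap F X) (amap F e)"
  using is_idempotentD[OF e] functor_Ob[OF F] functor_hom[OF F] functor_Comp[OF F, of e X X e X]
  by (simp add: is_idempotent_def)

text \<open>A bare component \<open>\<tau> X\<close> need not absorb the idempotents of
  \<open>(omap H X, amap H e)\<close> and \<open>(omap K X, amap K e)\<close>. Precomposing it with
  \<open>amap H e\<close> repairs this; by naturality, postcomposing with \<open>amap K e\<close>
  would give the same arrow.\<close>

definition completion_nat ::
  "('o2, 'm2) cat \<Rightarrow> ('o1, 'm1, 'o2, 'm2) fnctr \<Rightarrow> ('o1, 'm1, 'o2, 'm2) fnctr \<Rightarrow> ('o1 \<Rightarrow> 'm2) \<Rightarrow>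
    ('o1, 'm1) compl_ob \<Rightarrow> ('o2, 'm2) compl_ar" where
  "completion_nat B H K \<tau> = (\<lambda>(X, e).
     ((omap H X, amap H e), \<tau> X \<cdot>\<^bsub>B\<^esub> amap H e, (omap K X, amap K e)))"

lemma completion_nat_trans:
  assumes t: "is_nat_trans A B H K \<tau>"
  shows "is_nat_trans (completion A) (completion B) (completion_fun H) (completion_fun K)
    (completion_nat B H K \<tau>)"
proof -
  note H = nat_functor(1)[OF t] and K = nat_functor(2)[OF t]
  interpret A: category A using H by (rule is_functorD)
  interpret B: category B using H by (rule is_functorD)
  show ?thesis
  proof (rule is_nat_transI[OF is_functor_completion_fun[OF H] is_functor_completion_fun[OF K]])
    fix Z assume Z: "Z \<in> Ob (completion A)"
    obtain X e where [simp]: "Z = (X, e)" by (cases Z)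
    have i: "is_idempotent A X e" using Z by (simp add: completion_simps)
    note iD = is_idempotentD[OF i]
    note iH = functor_idempotent[OF H i] and iK = functor_idempotent[OF K i]
    note iHD = is_idempotentD[OF iH]
    note tX = nat_hom[OF t iD(1)]
    \<comment> \<open>Naturality at \<open>e\<close> turns the outer idempotent into a second copy
      of the inner one, which idempotence absorbs.\<close>
    have "amap K e \<cdot>\<^bsub>B\<^esub> \<tau> X \<cdot>\<^bsub>B\<^esub> amap H e = (\<tau> X \<cdot>\<^bsub>B\<^esub> amap H e) \<cdot>\<^bsub>B\<^esub> amap H e"
      using nat_square[OF t iD(2)] B.Comp_assoc[OF iHD(2) tX is_idempotentD(2)[OF iK]] by simp
    then show "completion_nat B H K \<tau> Z \<in>
        hom (completion B) (omap (completion_fun H) Z) (omap (completion_fun K) Z)"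
      using iH iK B.Comp_hom[OF iHD(2) tX] B.Comp_assoc[OF iHD(2,2) tX] iHD(3)
      by (simp add: completion_nat_def completion_fun_simps hom_completion_iff[OF B.category_axioms])
  next
    fix Z W f assume f: "f \<in> hom (completion A) Z W"
    obtain X e Y d where [simp]: "Z = (X, e)" "W = (Y, d)" by (cases Z, cases W)
    obtain g where [simp]: "f = ((X, e), g, (Y, d))" and i: "is_idempotent A X e" "is_idempotent A Y d"
      and g: "g \<in> hom A X Y" "d \<cdot>\<^bsub>A\<^esub> g = g" "g \<cdot>\<^bsub>A\<^esub> e = g"
      using f by (auto simp: hom_completion_iff[OF A.category_axioms])
    note eD = is_idempotentD[OF i(1)] and dD = is_idempotentD[OF i(2)]
    note c = functor_hom[OF H eD(2)] functor_hom[OF H dD(2)] functor_hom[OF H g(1)]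
      functor_hom[OF K g(1)] nat_hom[OF t eD(1)] nat_hom[OF t dD(1)]
    have "(\<tau> Y \<cdot>\<^bsub>B\<^esub> amap H d) \<cdot>\<^bsub>B\<^esub> amap H g = \<tau> Y \<cdot>\<^bsub>B\<^esub> amap H g"
      using B.Comp_assoc[OF c(3,2,6)] functor_Comp[OF H g(1) dD(2)] g(2) by simp
    also have "\<dots> = \<tau> Y \<cdot>\<^bsub>B\<^esub> (amap H g \<cdot>\<^bsub>B\<^esub> amap H e)"
      using functor_Comp[OF H eD(2) g(1)] g(3) by simp
    also have "\<dots> = amap K g \<cdot>\<^bsub>B\<^esub> (\<tau> X \<cdot>\<^bsub>B\<^esub> amap H e)"
      using B.Comp_assoc[OF c(1,3,6)] B.Comp_assoc[OF c(1,5,4)] nat_square[OF t g(1)] by simp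
    finally show "completion_nat B H K \<tau> W \<cdot>\<^bsub>completion B\<^esub> amap (completion_fun H) f =
        amap (completion_fun K) f \<cdot>\<^bsub>completion B\<^esub> completion_nat B H K \<tau> Z"
      by (simp add: completion_nat_def completion_fun_simps completion_simps)
  qed
qed

text \<open>Naturality at \<open>e\<close> merges the two idempotents, and the cancellation of
  \<tau> against \<sigma> leaves \<open>amap H e\<close>, the identity of the completed object. The
  one-sided form serves twice: applied in both directions it yields inverses of natural
  isomorphisms, and with a counit for \<sigma> and a unit for \<tau> it is the bireflection
  equation.\<close>

lemma completion_nat_inverse:
  assumes s: "is_nat_trans A B H K \<sigma>" and t: "is_nat_trans A B K H \<tau>"
    and ts: "\<And>X. X \<in> Ob A \<Longrightarrow> \<tau> X \<cdot>\<^bsub>B\<^esub> \<sigma> X = Iden B (omap H X)"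
    and Z: "Z \<in> Ob (completion A)"
  shows "completion_nat B K H \<tau> Z \<cdot>\<^bsub>completion B\<^esub> completion_nat B H K \<sigma> Z =
    Iden (completion B) (omap (completion_fun H) Z)"
proof -
  note H = nat_functor(1)[OF s] and K = nat_functor(2)[OF s]
  interpret B: category B using H by (rule is_functorD)
  obtain X e where [simp]: "Z = (X, e)" by (cases Z)
  have i: "is_idempotent A X e" using Z by (simp add: completion_simps)
  note iD = is_idempotentD[OF i]
  note iHD = is_idempotentD[OF functor_idempotent[OF H i]]
  note c = iHD(2) functor_hom[OF K iD(2)] nat_hom[OF s iD(1)] nat_hom[OF t iD(1)]
  have "(\<tau> X \<cdot>\<^bsub>B\<^esub> amap K e) \<cdot>\<^bsub>B\<^esub> \<sigma> X \<cdot>\<^bsub>B\<^esub> amap H e = \<tau> X \<cdot>\<^bsub>B\<^esub> (amap K e \<cdot>\<^bsub>B\<^esub> \<sigma> X) \<cdot>\<^bsub>B\<^esub> amap H e"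
    using B.Comp_assoc[OF B.Comp_hom[OF c(1,3)] c(2,4)] B.Comp_assoc[OF c(1,3,2)] by simp
  also have "\<dots> = \<tau> X \<cdot>\<^bsub>B\<^esub> \<sigma> X \<cdot>\<^bsub>B\<^esub> amap H e"
    using nat_square[OF s iD(2)] B.Comp_assoc[OF c(1,1,3)] iHD(3) by simp
  also have "\<dots> = amap H e"
    using B.Comp_cancel_mid[OF c(3,4) ts[OF iD(1)] refl c(1)] .
  finally show ?thesis
    by (simp add: completion_nat_def completion_fun_simps completion_simps)
qed

lemma completion_nat_iso:
  assumes s: "is_nat_iso A B H K \<sigma>"
  shows "is_nat_iso (completion A) (completion B) (completion_fun H) (completion_fun K)
    (completion_nat B H K \<sigma>)"
proof -
  obtain \<tau> where t: "is_nat_trans A B H K \<sigma>" "is_nat_trans A B K H \<tau>"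
    "\<And>X. X \<in> Ob A \<Longrightarrow> \<tau> X \<cdot>\<^bsub>B\<^esub> \<sigma> X = Iden B (omap H X)"
    "\<And>X. X \<in> Ob A \<Longrightarrow> \<sigma> X \<cdot>\<^bsub>B\<^esub> \<tau> X = Iden B (omap K X)"
    by (rule nat_isoE[OF s]) (rule that; blast)
  show ?thesis
    using nat_isoI[OF completion_nat_trans[OF t(1)] completion_nat_trans[OF t(2)]]
      completion_nat_inverse[OF t(1,2,3)] completion_nat_inverse[OF t(2,1,4)] by blast
qed

text \<open>An arrow of the completion is an arrow of the base with two absorption laws. Fullness of
  \<open>F\<close> lifts the arrow, and faithfulness lifts the laws.\<close>

lemma completion_fully_faithful:
  fixes A :: "('a, 'b) cat"
  assumes F: "fully_faithful A B F"
  shows "fully_faithful (completion A) (completion B) (completion_fun F)"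
proof (rule fully_faithfulI[OF is_functor_completion_fun[OF ff_functor[OF F]]])
  note FF = ff_functor[OF F]
  interpret A: category A using FF by (rule is_functorD)
  interpret B: category B using FF by (rule is_functorD)
  fix Z W :: "('a, 'b) compl_ob"
  obtain X e Y d where [simp]: "Z = (X, e)" "W = (Y, d)" by (cases Z, cases W)
  show "f = g" if "f \<in> hom (completion A) Z W" "g \<in> hom (completion A) Z W"
    "amap (completion_fun F) f = amap (completion_fun F) g" for f g
    using that faithful[OF F]
    by (auto simp: hom_completion_iff[OF A.category_axioms] completion_fun_simps)
  show "\<exists>f\<in>hom (completion A) Z W. amap (completion_fun F) f = h"
    if Z: "Z \<in> Ob (completion A)" and W: "W \<in> Ob (completion A)"
      and h: "h \<in> hom (completion B) (omap (completion_fun F) Z) (omap (completion_fun F) W)" for h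
  proof -
    have i: "is_idempotent A X e" "is_idempotent A Y d" using Z W by (simp_all add: completion_simps)
    note eD = is_idempotentD[OF i(1)] and dD = is_idempotentD[OF i(2)]
    obtain k where k: "h = ((omap F X, amap F e), k, (omap F Y, amap F d))"
      "k \<in> hom B (omap F X) (omap F Y)" "amap F d \<cdot>\<^bsub>B\<^esub> k = k" "k \<cdot>\<^bsub>B\<^esub> amap F e = k"
      using h by (auto simp: hom_completion_iff[OF B.category_axioms] completion_fun_simps)
    obtain f where f: "f \<in> hom A X Y" "amap F f = k" using full[OF F eD(1) dD(1) k(2)] by blast
    have "d \<cdot>\<^bsub>A\<^esub> f = f" "f \<cdot>\<^bsub>A\<^esub> e = f"
      using faithful[OF F A.Comp_hom[OF f(1) dD(2)] f(1)] faithful[OF F A.Comp_hom[OF eD(2) f(1)] f(1)]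
        functor_Comp[OF FF f(1) dD(2)] functor_Comp[OF FF eD(2) f(1)] f(2) k(3,4) by simp_all
    then have "((X, e), f, (Y, d)) \<in> hom (completion A) Z W"
      using i f(1) by (simp add: hom_completion_iff[OF A.category_axioms])
    moreover have "amap (completion_fun F) ((X, e), f, (Y, d)) = h"
      using k(1) f(2) by (simp add: completion_fun_simps)
    ultimately show ?thesis by blast
  qed
qed

text \<open>At \<open>(X, e)\<close> the first triangle must give \<open>amap L e\<close>, the
  identity of the completed object, rather than an identity of \<open>B\<close>; similarly for the
  second. Naturality gathers the idempotents at one end of the composite, where the old triangle
  identity leaves just one of them.\<close>

lemma completion_adjunction:
  assumes adj: "adjunction A B L R \<eta> \<epsilon>"
  shows "adjunction (completion A) (completion B) (completion_fun L) (completion_fun R)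
    (completion_nat A id_fun (R \<circ>\<^sub>F L) \<eta>) (completion_nat B (L \<circ>\<^sub>F R) id_fun \<epsilon>)"
proof -
  note L = adjunctionD(1)[OF adj] and R = adjunctionD(2)[OF adj] and
    \<eta> = adjunctionD(3)[OF adj] and \<epsilon> = adjunctionD(4)[OF adj] and
    tri1 = adjunctionD(5)[OF adj] and tri2 = adjunctionD(6)[OF adj]
  interpret A: category A using L by (rule is_functorD)
  interpret B: category B using L by (rule is_functorD)
  have "completion_nat B (L \<circ>\<^sub>F R) id_fun \<epsilon> (omap (completion_fun L) Z) \<cdot>\<^bsub>completion B\<^esub>
      amap (completion_fun L) (completion_nat A id_fun (R \<circ>\<^sub>F L) \<eta> Z) =
      Iden (completion B) (omap (completion_fun L) Z)" if Z: "Z \<in> Ob (completion A)" for Z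
  proof -
    obtain X e where [simp]: "Z = (X, e)" by (cases Z)
    have i: "is_idempotent A X e" using Z by (simp add: completion_simps)
    note iD = is_idempotentD[OF i]
    note LX = functor_Ob[OF L iD(1)]
    note Le = functor_hom[OF L iD(2)] and RLe = functor_hom[OF R functor_hom[OF L iD(2)]]
    note h = nat_hom[OF \<eta> iD(1), unfolded fun_simps] and e = nat_hom[OF \<epsilon> LX, unfolded fun_simps]
    note he = A.Comp_hom[OF iD(2) h]
    note Lh = functor_hom[OF L h] and Lhe = functor_hom[OF L he]
    \<comment> \<open>The completed unit component absorbs the idempotent of its target, so the
      extra factor brought in by the counit component disappears.\<close>
    have "amap R (amap L e) \<cdot>\<^bsub>A\<^esub> (\<eta> X \<cdot>\<^bsub>A\<^esub> e) = \<eta> X \<cdot>\<^bsub>A\<^esub> e"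
      using nat_square[OF \<eta> iD(2), unfolded fun_simps] A.Comp_assoc[OF iD(2) h RLe]
        A.Comp_assoc[OF iD(2,2) h] iD(3) by simp
    then have "amap L (amap R (amap L e)) \<cdot>\<^bsub>B\<^esub> amap L (\<eta> X \<cdot>\<^bsub>A\<^esub> e) = amap L (\<eta> X) \<cdot>\<^bsub>B\<^esub> amap L e"
      using functor_Comp[OF L he RLe] functor_Comp[OF L iD(2) h] by simp
    then have "(\<epsilon> (omap L X) \<cdot>\<^bsub>B\<^esub> amap L (amap R (amap L e))) \<cdot>\<^bsub>B\<^esub> amap L (\<eta> X \<cdot>\<^bsub>A\<^esub> e) = amap L e"
      using B.Comp_assoc[OF Lhe functor_hom[OF L RLe] e]
        B.Comp_cancel_mid[OF Lh e tri1[OF iD(1)] refl Le] by simp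
    then show ?thesis
      by (simp add: completion_nat_def completion_fun_simps completion_simps fun_simps)
  qed
  moreover have "amap (completion_fun R) (completion_nat B (L \<circ>\<^sub>F R) id_fun \<epsilon> Z) \<cdot>\<^bsub>completion A\<^esub>
      completion_nat A id_fun (R \<circ>\<^sub>F L) \<eta> (omap (completion_fun R) Z) =
      Iden (completion A) (omap (completion_fun R) Z)" if Z: "Z \<in> Ob (completion B)" for Z
  proof -
    obtain Y e where [simp]: "Z = (Y, e)" by (cases Z)
    have i: "is_idempotent B Y e" using Z by (simp add: completion_simps)
    note iD = is_idempotentD[OF i]
    note RY = functor_Ob[OF R iD(1)]
    note iRD = is_idempotentD[OF functor_idempotent[OF R i]]
    note Re = functor_hom[OF R iD(2)] and LRe = functor_hom[OF L functor_hom[OF R iD(2)]]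
    note h = nat_hom[OF \<eta> RY, unfolded fun_simps] and e = nat_hom[OF \<epsilon> iD(1), unfolded fun_simps]
    note c = Re h functor_hom[OF R LRe] functor_hom[OF R e]
    \<comment> \<open>Naturality of \<epsilon> at \<open>e\<close> moves the idempotent to the
      front, out of the way of the triangle identity.\<close>
    have "amap R (\<epsilon> Y \<cdot>\<^bsub>B\<^esub> amap L (amap R e)) = amap R e \<cdot>\<^bsub>A\<^esub> amap R (\<epsilon> Y)"
      using nat_square[OF \<epsilon> iD(2), unfolded fun_simps] functor_Comp[OF R e iD(2)] by simp
    moreover have "amap R (\<epsilon> Y) \<cdot>\<^bsub>A\<^esub> (\<eta> (omap R Y) \<cdot>\<^bsub>A\<^esub> amap R e) = amap R e"
      using A.Comp_cancel_mid[OF c(2,4) tri2[OF iD(1)] refl Re] .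
    ultimately have "amap R (\<epsilon> Y \<cdot>\<^bsub>B\<^esub> amap L (amap R e)) \<cdot>\<^bsub>A\<^esub> (\<eta> (omap R Y) \<cdot>\<^bsub>A\<^esub> amap R e) = amap R e"
      using A.Comp_assoc[OF A.Comp_hom[OF c(1,2)] c(4) Re] iRD(3) by simp
    then show ?thesis
      by (simp add: completion_nat_def completion_fun_simps completion_simps fun_simps)
  qed
  ultimately show ?thesis
    using is_functor_completion_fun[OF L] is_functor_completion_fun[OF R]
      completion_nat_trans[OF \<eta>] completion_nat_trans[OF \<epsilon>]
    unfolding adjunction_def completion_fun_id completion_fun_comp by blast
qed

section \<open>Preservation of the four notions under idempotent completion\<close>

lemma coreflection_completion:
  assumes "coreflection D C G"
  shows "coreflection (completion D) (completion C) (completion_fun G)"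
  using assms completion_adjunction completion_fully_faithful is_functor_completion_fun
  unfolding coreflection_def by blast

lemma reflection_completion:
  assumes "reflection D C G"
  shows "reflection (completion D) (completion C) (completion_fun G)"
  using assms completion_adjunction completion_fully_faithful is_functor_completion_fun
  unfolding reflection_def by blast

lemma bireflection_completion:
  assumes "bireflection D C G"
  shows "bireflection (completion D) (completion C) (completion_fun G)"
proof -
  obtain F \<eta>\<^sub>l \<epsilon>\<^sub>l \<eta>\<^sub>r \<epsilon>\<^sub>r where G: "is_functor D C G" and ff: "fully_faithful C D F"
    and l: "adjunction C D F G \<eta>\<^sub>l \<epsilon>\<^sub>l" and r: "adjunction D C G F \<eta>\<^sub>r \<epsilon>\<^sub>r"
    and re: "\<And>X. X \<in> Ob D \<Longrightarrow> \<eta>\<^sub>r X \<cdot>\<^bsub>D\<^esub> \<epsilon>\<^sub>l X = Iden D (omap (F \<circ>\<^sub>F G) X)"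
    using assms unfolding bireflection_def by blast
  note \<epsilon>\<^sub>l = adjunctionD(4)[OF l] and \<eta>\<^sub>r = adjunctionD(3)[OF r]
  have "\<forall>Z \<in> Ob (completion D). completion_nat D id_fun (F \<circ>\<^sub>F G) \<eta>\<^sub>r Z \<cdot>\<^bsub>completion D\<^esub>
      completion_nat D (F \<circ>\<^sub>F G) id_fun \<epsilon>\<^sub>l Z =
      Iden (completion D) (omap (completion_fun F \<circ>\<^sub>F completion_fun G) Z)"
    using completion_nat_inverse[OF \<epsilon>\<^sub>l \<eta>\<^sub>r re] unfolding completion_fun_comp by blast
  then show ?thesis
    unfolding bireflection_def
    using completion_adjunction[OF l] completion_adjunction[OF r] completion_fully_faithful[OF ff]
      is_functor_completion_fun[OF G] by blast
qed

lemma equivalence_completion: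
  assumes "equivalence D C G"
  shows "equivalence (completion D) (completion C) (completion_fun G)"
proof -
  obtain F \<alpha> \<beta> where G: "is_functor D C G" and F: "is_functor C D F"
    and \<alpha>: "is_nat_iso D D id_fun (F \<circ>\<^sub>F G) \<alpha>" and \<beta>: "is_nat_iso C C (G \<circ>\<^sub>F F) id_fun \<beta>"
    using assms unfolding equivalence_def by blast
  show ?thesis
    using completion_nat_iso[OF \<alpha>] completion_nat_iso[OF \<beta>]
      is_functor_completion_fun[OF F] is_functor_completion_fun[OF G]
    unfolding equivalence_def completion_fun_id completion_fun_comp by blast
qed

section \<open>The embedding of a category into its idempotent completion\<close>

definition completion_embedding ::
  "('o, 'm) cat \<Rightarrow> ('o, 'm, ('o, 'm) compl_ob, ('o, 'm) compl_ar) fnctr" where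
  "completion_embedding C = \<lparr>omap = \<lambda>X. (X, Iden C X),
     amap = \<lambda>f. ((Dom C f, Iden C (Dom C f)), f, (Cod C f, Iden C (Cod C f)))\<rparr>"

lemma completion_embedding_simps:
  "omap (completion_embedding C) X = (X, Iden C X)"
  "f \<in> hom C X Y \<Longrightarrow> amap (completion_embedding C) f = ((X, Iden C X), f, (Y, Iden C Y))"
  by (auto simp: completion_embedding_def hom_def)

lemma (in category) idempotent_Iden: "X \<in> Ob C \<Longrightarrow> is_idempotent C X (Iden C X)"
  using Id_hom Comp_Id by (auto simp: is_idempotent_def)

text \<open>Between pairs \<open>(X, Id)\<close> and \<open>(Y, Id)\<close> the absorption laws
  reduce to the identity laws of \<open>C\<close>, so they hold for every arrow from
  \<open>X\<close> to \<open>Y\<close>.\<close>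

lemma completion_embedding_fully_faithful:
  assumes "category C"
  shows "fully_faithful C (completion C) (completion_embedding C)"
proof -
  interpret category C by fact
  show ?thesis
  proof (rule fully_faithfulI[OF is_functorI])
    show "category (completion C)" by (rule category_completion) fact
    show "amap (completion_embedding C) f \<in> hom (completion C)
        (omap (completion_embedding C) X) (omap (completion_embedding C) Y)"
      if "f \<in> hom C X Y" for X Y f
      using that hom_Ob[OF that] idempotent_Iden Comp_Id Id_Comp
      by (simp add: completion_embedding_simps hom_completion_iff[OF assms])
    show "amap (completion_embedding C) (g \<cdot>\<^bsub>C\<^esub> f) =
        amap (completion_embedding C) g \<cdot>\<^bsub>completion C\<^esub> amap (completion_embedding C) f"
      if "f \<in> hom C X Y" "g \<in> hom C Y Z" for X Y Z f g
      using that Comp_hom[OF that]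
      by (simp add: completion_embedding_simps(2)[of _ _ X] completion_embedding_simps(2)[of _ _ Y]
        completion_simps)
    show "\<exists>f\<in>hom C X Y. amap (completion_embedding C) f = h"
      if "h \<in> hom (completion C) (omap (completion_embedding C) X) (omap (completion_embedding C) Y)"
      for X Y h
      using that by (auto simp: completion_embedding_simps hom_completion_iff[OF assms])
  qed (use assms idempotent_Iden Id_hom in
      \<open>auto simp: completion_embedding_simps completion_simps\<close>)
qed

text \<open>The two halves of a splitting are mutually inverse in the completion: one composite is
  \<open>Iden D Y\<close>, and the other is \<open>e\<close>, which is the identity of
  \<open>(X, e)\<close>. This is where idempotent completeness of \<open>D\<close> enters.\<close>

lemma completion_embedding_dense:
  assumes D: "idempotent_complete D" and Z: "Z \<in> Ob (completion D)"
  shows "\<exists>Y \<in> Ob D. \<exists>u. is_iso (completion D) Z (omap (completion_embedding D) Y) u"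
proof -
  have cat: "category D" using D by (simp add: idempotent_complete_def)
  interpret category D by (rule cat)
  obtain X e where [simp]: "Z = (X, e)" by (cases Z)
  have i: "is_idempotent D X e" using Z by (simp add: completion_simps)
  then obtain Y p q where Y: "Y \<in> Ob D" and p: "p \<in> hom D X Y" and q: "q \<in> hom D Y X"
    and eq: "e = q \<cdot>\<^bsub>D\<^esub> p" and pq: "p \<cdot>\<^bsub>D\<^esub> q = Iden D Y"
    using D unfolding idempotent_complete_def by blast
  \<comment> \<open>Absorption of \<open>e\<close> follows by writing \<open>e\<close> as
    \<open>q\<close> after \<open>p\<close> and cancelling \<open>p\<close> after \<open>q\<close>;
    this makes \<open>p\<close> and \<open>q\<close> arrows of the completion.\<close>
  have pe: "p \<cdot>\<^bsub>D\<^esub> e = p"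
    using Comp_cancel_mid[OF q p pq refl p] eq by simp
  have qe: "e \<cdot>\<^bsub>D\<^esub> q = q"
    using Comp_assoc[OF q p q] Comp_Id[OF q] pq eq by simp
  have "is_iso (completion D) (X, e) (Y, Iden D Y) ((X, e), p, (Y, Iden D Y))"
    unfolding is_iso_def
  proof (intro conjI bexI)
    show "((X, e), p, (Y, Iden D Y)) \<in> hom (completion D) (X, e) (Y, Iden D Y)"
      using i p pe idempotent_Iden[OF Y] Id_Comp[OF p] by (simp add: hom_completion_iff[OF cat])
    show "((Y, Iden D Y), q, (X, e)) \<in> hom (completion D) (Y, Iden D Y) (X, e)"
      using i q qe idempotent_Iden[OF Y] Comp_Id[OF q] by (simp add: hom_completion_iff[OF cat])
  qed (simp_all add: completion_simps pq eq)
  then show ?thesis using Y unfolding completion_embedding_simps \<open>Z = (X, e)\<close> by blast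
qed

text \<open>Strict equality holds because \<open>G\<close> preserves identities: the image of
  \<open>(X, Id)\<close> is again a pair whose idempotent is an identity.\<close>

lemma completion_fun_intertwines:
  assumes G: "is_functor D C G"
  shows "intertwines D (completion_embedding D) (completion_embedding C) (completion_fun G) G"
  unfolding intertwines_def
proof (intro conjI ballI)
  interpret category D using G by (rule is_functorD)
  fix f assume f: "f \<in> Ar D"
  show "amap (completion_fun G) (amap (completion_embedding D) f) =
      amap (completion_embedding C) (amap G f)"
    using completion_embedding_simps(2)[OF Ar_hom[OF f]] functor_Id[OF G] Dom_Ob[OF f] Cod_Ob[OF f]
      completion_embedding_simps(2)[OF functor_hom[OF G Ar_hom[OF f]]]
    by (simp add: completion_fun_simps)
qed (use functor_Id[OF G] in \<open>simp add: completion_fun_simps completion_embedding_simps\<close>)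

theorem proposition2p12:
  fixes D :: "('o1, 'm1) cat" and C :: "('o2, 'm2) cat"
    and G :: "('o1, 'm1, 'o2, 'm2) fnctr"
  assumes "category D" and "category C"
    and "idempotent_complete D"
    and "is_functor D C G"
  shows "(coreflection_upto_retracts D C G \<longleftrightarrow> coreflection D C G) \<and>
         (reflection_upto_retracts D C G \<longleftrightarrow> reflection D C G) \<and>
         (bireflection_upto_retracts D C G \<longleftrightarrow> bireflection D C G) \<and>
         (equivalence_upto_retracts D C G \<longleftrightarrow> equivalence D C G)"
proof -
  interpret dense_square D C "completion D" "completion C" "completion_embedding D"
    "completion_embedding C" "completion_fun G" G
    by unfold_locales
      (use assms completion_embedding_fully_faithful completion_embedding_dense
        is_functor_completion_fun completion_fun_intertwines in blast)+
  show ?thesis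
    unfolding coreflection_upto_retracts_def reflection_upto_retracts_def
      bireflection_upto_retracts_def equivalence_upto_retracts_def
    using coreflection_restrict reflection_restrict bireflection_restrict equivalence_restrict
      coreflection_completion reflection_completion bireflection_completion equivalence_completion
    by blast
qed

end
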